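(* Let $(\mathscr{A},\mathscr{E})$ be an exact category. Consider a commutative diagram $$\begin{array}{ccccc} A' & \xrightarrow{f'} & B' & \xrightarrow{g'} & C'\\ {\scriptstyle a}\downarrow & & {\scriptstyle b}\downarrow & & {\scriptstyle c}\downarrow\\ A & \xrightarrow{f} & B & \xrightarrow{g} & C\\ {\scriptstyle a'}\downarrow & & {\scriptstyle b'}\downarrow & & {\scriptstyle c'}\downarrow\\ A'' & \xrightarrow{f''} & B'' & \xrightarrow{g''} & C''\end{array}$$ in $\mathscr{A}$ in which the columns $(a,a')$, $(b,b')$, $(c,c')$ are short exact sequences, and assume in addition that one of the following conditions holds: (i) the middle row and either one of the outer rows is short exact; (ii) the two outer rows are short exact and $gf=0$. Then the remaining row is short exact as well.
   Context: A kernel-cokernel pair in an additive category $\mathscr{A}$ is a pair of composable morphisms $A'\xrightarrow{i}A\xrightarrow{p}A''$ such that $i$ is a kernel of $p$ and $p$ is a cokernel of $i$. Given a class $\mathscr{E}$ of kernel-cokernel pairs, an admissible monic is a morphism $i$ for which there is $p$ with $(i,p)\in\mathscr{E}$; an admissible epic is a morphism $p$ for which there is $i$ with $(i,p)\in\mathscr{E}$. An exact structure on $\mathscr{A}$ is a class $\mathscr{E}$ of kernel-cokernel pairs closed under isomorphisms such that: all identity morphisms are admissible monics and admissible epics; admissible monics are closed under composition and admissible epics are closed under composition; the push-out of an admissible monic along an arbitrary morphism exists and yields an admissible monic; the pull-back of an admissible epic along an arbitrary morphism exists and yields an admissible epic. An exact category is a pair $(\mathscr{A},\mathscr{E})$ of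 an additive category and an exact structure on it; elements of $\mathscr{E}$ are called short exact sequences. *)

theory Defs
  imports "HOL-Algebra.Group"
begin

section \<open>Additive categories\<close>

text \<open>
  Composition is written in the usual order, \<open>g \<cdot> f\<close> meaning \<open>f\<close> first. The values of
  \<open>Comp\<close>, \<open>Plus\<close>, \<open>Zero\<close> and \<open>Id\<close> only matter on composable or parallel arrows and on
  objects, respectively.
\<close>

record ('o, 'm) ab_category =
  Obj :: "'o set"
  Arr :: "'m set"
  Dom :: "'m \<Rightarrow> 'o"
  Cod :: "'m \<Rightarrow> 'o"
  Id :: "'o \<Rightarrow> 'm"
  Comp :: "'m \<Rightarrow> 'm \<Rightarrow> 'm"  (infixl "\<cdot>\<index>" 70)
  Plus :: "'m \<Rightarrow> 'm \<Rightarrow> 'm"  (infixl "\<boxplus>\<index>" 65)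
  Zero :: "'o \<Rightarrow> 'o \<Rightarrow> 'm"

definition Hom :: "('o, 'm, 'x) ab_category_scheme \<Rightarrow> 'o \<Rightarrow> 'o \<Rightarrow> 'm set" where
  "Hom \<C> A B = {f \<in> Arr \<C>. Dom \<C> f = A \<and> Cod \<C> f = B}"

definition hom_group :: "('o, 'm, 'x) ab_category_scheme \<Rightarrow> 'o \<Rightarrow> 'o \<Rightarrow> 'm monoid" where
  "hom_group \<C> A B = \<lparr>carrier = Hom \<C> A B, mult = Plus \<C>, one = Zero \<C> A B\<rparr>"

locale category =
  fixes \<C> :: "('o, 'm, 'x) ab_category_scheme" (structure)
  assumes dom_obj: "f \<in> Arr \<C> \<Longrightarrow> Dom \<C> f \<in> Obj \<C>"
    and cod_obj: "f \<in> Arr \<C> \<Longrightarrow> Cod \<C> f \<in> Obj \<C>"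
    and id_hom: "A \<in> Obj \<C> \<Longrightarrow> Id \<C> A \<in> Hom \<C> A A"
    and comp_hom: "\<lbrakk>f \<in> Hom \<C> A B; g \<in> Hom \<C> B D\<rbrakk> \<Longrightarrow> g \<cdot> f \<in> Hom \<C> A D"
    and comp_assoc: "\<lbrakk>f \<in> Hom \<C> A B; g \<in> Hom \<C> B D; h \<in> Hom \<C> D F\<rbrakk>
      \<Longrightarrow> (h \<cdot> g) \<cdot> f = h \<cdot> (g \<cdot> f)"
    and comp_id: "f \<in> Hom \<C> A B \<Longrightarrow> f \<cdot> Id \<C> A = f"
    and id_comp: "f \<in> Hom \<C> A B \<Longrightarrow> Id \<C> B \<cdot> f = f"

locale preadditive_category = category +
  assumes hom_comm_group: "\<lbrakk>A \<in> Obj \<C>; B \<in> Obj \<C>\<rbrakk> \<Longrightarrow> comm_group (hom_group \<C> A B)"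
    and comp_plus: "\<lbrakk>f \<in> Hom \<C> A B; g \<in> Hom \<C> A B; h \<in> Hom \<C> B D\<rbrakk>
      \<Longrightarrow> h \<cdot> (f \<boxplus> g) = (h \<cdot> f) \<boxplus> (h \<cdot> g)"
    and plus_comp: "\<lbrakk>f \<in> Hom \<C> A B; g \<in> Hom \<C> B D; h \<in> Hom \<C> B D\<rbrakk>
      \<Longrightarrow> (g \<boxplus> h) \<cdot> f = (g \<cdot> f) \<boxplus> (h \<cdot> f)"

definition zero_object :: "('o, 'm, 'x) ab_category_scheme \<Rightarrow> 'o \<Rightarrow> bool" where
  "zero_object \<C> Z \<longleftrightarrow> Z \<in> Obj \<C> \<and>
     (\<forall>A \<in> Obj \<C>. (\<exists>!f. f \<in> Hom \<C> Z A) \<and> (\<exists>!f. f \<in> Hom \<C> A Z))"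

definition biproduct ::
  "('o, 'm, 'x) ab_category_scheme \<Rightarrow> 'o \<Rightarrow> 'o \<Rightarrow> 'o \<Rightarrow> 'm \<Rightarrow> 'm \<Rightarrow> 'm \<Rightarrow> 'm \<Rightarrow> bool" where
  "biproduct \<C> A B S i j p q \<longleftrightarrow>
     i \<in> Hom \<C> A S \<and> j \<in> Hom \<C> B S \<and> p \<in> Hom \<C> S A \<and> q \<in> Hom \<C> S B \<and>
     p \<cdot>\<^bsub>\<C>\<^esub> i = Id \<C> A \<and> q \<cdot>\<^bsub>\<C>\<^esub> j = Id \<C> B \<and>
     p \<cdot>\<^bsub>\<C>\<^esub> j = Zero \<C> B A \<and> q \<cdot>\<^bsub>\<C>\<^esub> i = Zero \<C> A B \<and>
     (i \<cdot>\<^bsub>\<C>\<^esub> p) \<boxplus>\<^bsub>\<C>\<^esub> (j \<cdot>\<^bsub>\<C>\<^esub> q) = Id \<C> S"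

locale additive_category = preadditive_category +
  assumes ex_zero_object: "\<exists>Z. zero_object \<C> Z"
    and ex_biproduct: "\<lbrakk>A \<in> Obj \<C>; B \<in> Obj \<C>\<rbrakk>
      \<Longrightarrow> \<exists>S \<in> Obj \<C>. \<exists>i j p q. biproduct \<C> A B S i j p q"


section \<open>Kernels, cokernels, push-outs and pull-backs\<close>

definition is_kernel :: "('o, 'm, 'x) ab_category_scheme \<Rightarrow> 'm \<Rightarrow> 'm \<Rightarrow> bool" where
  "is_kernel \<C> i p \<longleftrightarrow>
     i \<in> Arr \<C> \<and> p \<in> Arr \<C> \<and> Cod \<C> i = Dom \<C> p \<and>
     p \<cdot>\<^bsub>\<C>\<^esub> i = Zero \<C> (Dom \<C> i) (Cod \<C> p) \<and>
     (\<forall>X \<in> Obj \<C>. \<forall>t \<in> Hom \<C> X (Dom \<C> p). p \<cdot>\<^bsub>\<C>\<^esub> t = Zero \<C> X (Cod \<C> p) \<longrightarrow>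
        (\<exists>!u. u \<in> Hom \<C> X (Dom \<C> i) \<and> i \<cdot>\<^bsub>\<C>\<^esub> u = t))"

definition is_cokernel :: "('o, 'm, 'x) ab_category_scheme \<Rightarrow> 'm \<Rightarrow> 'm \<Rightarrow> bool" where
  "is_cokernel \<C> p i \<longleftrightarrow>
     i \<in> Arr \<C> \<and> p \<in> Arr \<C> \<and> Cod \<C> i = Dom \<C> p \<and>
     p \<cdot>\<^bsub>\<C>\<^esub> i = Zero \<C> (Dom \<C> i) (Cod \<C> p) \<and>
     (\<forall>X \<in> Obj \<C>. \<forall>t \<in> Hom \<C> (Cod \<C> i) X. t \<cdot>\<^bsub>\<C>\<^esub> i = Zero \<C> (Dom \<C> i) X \<longrightarrow>
        (\<exists>!u. u \<in> Hom \<C> (Cod \<C> p) X \<and> u \<cdot>\<^bsub>\<C>\<^esub> p = t))"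

definition kernel_cokernel_pair :: "('o, 'm, 'x) ab_category_scheme \<Rightarrow> 'm \<Rightarrow> 'm \<Rightarrow> bool" where
  "kernel_cokernel_pair \<C> i p \<longleftrightarrow> is_kernel \<C> i p \<and> is_cokernel \<C> p i"

definition is_iso :: "('o, 'm, 'x) ab_category_scheme \<Rightarrow> 'm \<Rightarrow> bool" where
  "is_iso \<C> f \<longleftrightarrow> f \<in> Arr \<C> \<and>
     (\<exists>g \<in> Hom \<C> (Cod \<C> f) (Dom \<C> f).
        g \<cdot>\<^bsub>\<C>\<^esub> f = Id \<C> (Dom \<C> f) \<and> f \<cdot>\<^bsub>\<C>\<^esub> g = Id \<C> (Cod \<C> f))"

definition iso_pairs ::
  "('o, 'm, 'x) ab_category_scheme \<Rightarrow> 'm \<Rightarrow> 'm \<Rightarrow> 'm \<Rightarrow> 'm \<Rightarrow> bool" where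
  "iso_pairs \<C> i p j q \<longleftrightarrow>
     (\<exists>\<alpha> \<beta> \<gamma>. is_iso \<C> \<alpha> \<and> is_iso \<C> \<beta> \<and> is_iso \<C> \<gamma> \<and>
        \<alpha> \<in> Hom \<C> (Dom \<C> i) (Dom \<C> j) \<and>
        \<beta> \<in> Hom \<C> (Cod \<C> i) (Cod \<C> j) \<and>
        \<gamma> \<in> Hom \<C> (Cod \<C> p) (Cod \<C> q) \<and>
        j \<cdot>\<^bsub>\<C>\<^esub> \<alpha> = \<beta> \<cdot>\<^bsub>\<C>\<^esub> i \<and> q \<cdot>\<^bsub>\<C>\<^esub> \<beta> = \<gamma> \<cdot>\<^bsub>\<C>\<^esub> p)"

text \<open>
  In \<open>is_pushout \<C> i f i' f'\<close> the span is \<open>i : A \<rightarrow> B\<close>, \<open>f : A \<rightarrow> A'\<close> and the cospan is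
  \<open>i' : A' \<rightarrow> B'\<close>, \<open>f' : B \<rightarrow> B'\<close>, so \<open>i'\<close> is the push-out of \<open>i\<close> along \<open>f\<close>.
\<close>

definition is_pushout ::
  "('o, 'm, 'x) ab_category_scheme \<Rightarrow> 'm \<Rightarrow> 'm \<Rightarrow> 'm \<Rightarrow> 'm \<Rightarrow> bool" where
  "is_pushout \<C> i f i' f' \<longleftrightarrow>
     i \<in> Arr \<C> \<and> f \<in> Arr \<C> \<and> Dom \<C> i = Dom \<C> f \<and>
     i' \<in> Hom \<C> (Cod \<C> f) (Cod \<C> i') \<and> f' \<in> Hom \<C> (Cod \<C> i) (Cod \<C> i') \<and>
     f' \<cdot>\<^bsub>\<C>\<^esub> i = i' \<cdot>\<^bsub>\<C>\<^esub> f \<and>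
     (\<forall>X \<in> Obj \<C>. \<forall>s \<in> Hom \<C> (Cod \<C> i) X. \<forall>t \<in> Hom \<C> (Cod \<C> f) X.
        s \<cdot>\<^bsub>\<C>\<^esub> i = t \<cdot>\<^bsub>\<C>\<^esub> f \<longrightarrow>
        (\<exists>!u. u \<in> Hom \<C> (Cod \<C> i') X \<and> u \<cdot>\<^bsub>\<C>\<^esub> f' = s \<and> u \<cdot>\<^bsub>\<C>\<^esub> i' = t))"

text \<open>
  In \<open>is_pullback \<C> p f p' f'\<close> the cospan is \<open>p : B \<rightarrow> C\<close>, \<open>f : C' \<rightarrow> C\<close> and the span is
  \<open>p' : B' \<rightarrow> C'\<close>, \<open>f' : B' \<rightarrow> B\<close>, so \<open>p'\<close> is the pull-back of \<open>p\<close> along \<open>f\<close>.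
\<close>

definition is_pullback ::
  "('o, 'm, 'x) ab_category_scheme \<Rightarrow> 'm \<Rightarrow> 'm \<Rightarrow> 'm \<Rightarrow> 'm \<Rightarrow> bool" where
  "is_pullback \<C> p f p' f' \<longleftrightarrow>
     p \<in> Arr \<C> \<and> f \<in> Arr \<C> \<and> Cod \<C> p = Cod \<C> f \<and>
     p' \<in> Hom \<C> (Dom \<C> p') (Dom \<C> f) \<and> f' \<in> Hom \<C> (Dom \<C> p') (Dom \<C> p) \<and>
     p \<cdot>\<^bsub>\<C>\<^esub> f' = f \<cdot>\<^bsub>\<C>\<^esub> p' \<and>
     (\<forall>X \<in> Obj \<C>. \<forall>s \<in> Hom \<C> X (Dom \<C> p). \<forall>t \<in> Hom \<C> X (Dom \<C> f).
        p \<cdot>\<^bsub>\<C>\<^esub> s = f \<cdot>\<^bsub>\<C>\<^esub> t \<longrightarrow>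
        (\<exists>!u. u \<in> Hom \<C> X (Dom \<C> p') \<and> f' \<cdot>\<^bsub>\<C>\<^esub> u = s \<and> p' \<cdot>\<^bsub>\<C>\<^esub> u = t))"


section \<open>Exact categories\<close>

definition admissible_monic :: "('m \<times> 'm) set \<Rightarrow> 'm \<Rightarrow> bool" where
  "admissible_monic \<E> i \<longleftrightarrow> (\<exists>p. (i, p) \<in> \<E>)"

definition admissible_epic :: "('m \<times> 'm) set \<Rightarrow> 'm \<Rightarrow> bool" where
  "admissible_epic \<E> p \<longleftrightarrow> (\<exists>i. (i, p) \<in> \<E>)"

text \<open>
  Push-outs and pull-backs are unique up to isomorphism and \<open>\<E>\<close> is closed under
  isomorphisms, so in \<open>pushout_monic\<close> and \<open>pullback_epic\<close> it does not matter whether one or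
  every push-out (pull-back) is required to be admissible.
\<close>

locale exact_category = additive_category +
  fixes \<E> :: "('m \<times> 'm) set"
  assumes kernel_cokernel: "(i, p) \<in> \<E> \<Longrightarrow> kernel_cokernel_pair \<C> i p"
    and iso_closed: "\<lbrakk>(i, p) \<in> \<E>; kernel_cokernel_pair \<C> j q; iso_pairs \<C> i p j q\<rbrakk>
      \<Longrightarrow> (j, q) \<in> \<E>"
    and id_monic: "A \<in> Obj \<C> \<Longrightarrow> admissible_monic \<E> (Id \<C> A)"
    and id_epic: "A \<in> Obj \<C> \<Longrightarrow> admissible_epic \<E> (Id \<C> A)"
    and comp_monic: "\<lbrakk>admissible_monic \<E> i; admissible_monic \<E> j; Cod \<C> i = Dom \<C> j\<rbrakk>
      \<Longrightarrow> admissible_monic \<E> (j \<cdot> i)"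
    and comp_epic: "\<lbrakk>admissible_epic \<E> p; admissible_epic \<E> q; Cod \<C> p = Dom \<C> q\<rbrakk>
      \<Longrightarrow> admissible_epic \<E> (q \<cdot> p)"
    and pushout_monic: "\<lbrakk>admissible_monic \<E> i; f \<in> Arr \<C>; Dom \<C> f = Dom \<C> i\<rbrakk>
      \<Longrightarrow> \<exists>i' f'. is_pushout \<C> i f i' f' \<and> admissible_monic \<E> i'"
    and pullback_epic: "\<lbrakk>admissible_epic \<E> p; f \<in> Arr \<C>; Cod \<C> f = Cod \<C> p\<rbrakk>
      \<Longrightarrow> \<exists>p' f'. is_pullback \<C> p f p' f' \<and> admissible_epic \<E> p'"

end

(*
  Duality reduces the case of a missing upper row to that of a missing lower row.

  Lower row: let D be the push-out of f' along a. It is an extension of C' by A and of A'' by B',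
  and it is the pull-back of g along c, so that B' -> D -> B are admissible monics with cokernels
  A'' (of B' -> D), B'' (of B' -> B) and C'' (of D -> B). Noether's isomorphism theorem applies.

  Middle row: let D be the kernel of g'' b'. Noether's theorem for epics makes B' -> D -> A'' short
  exact, hence D is again the push-out of f' along a, and f is the composite of the admissible
  monics A -> D -> B. For the cokernel K of f, Noether's theorem gives C' -> K -> C'', and the
  map K -> C induced by g f = 0 is an isomorphism by the short five lemma.
*)

theory Submission
  imports Defs
begin

text \<open>Membership in a hom-set is unfolded into conditions on \<open>Arr\<close>,
  \<open>Dom\<close> and \<open>Cod\<close>, which the simplifier can discharge. The rule is
  switched off where a hom-set has to remain visible, for instance as the carrier of a
  group.\<close>

lemma Hom_iff [simp]: "f \<in> Hom \<C> A B \<longleftrightarrow> f \<in> Arr \<C> \<and> Dom \<C> f = A \<and> Cod \<C> f = B"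
  by (simp add: Hom_def)

section \<open>Categories and preadditive categories\<close>

context category
begin

declare dom_obj [simp] cod_obj [simp]

lemma comp_arr [simp]:
  assumes "f \<in> Arr \<C>" "g \<in> Arr \<C>" "Cod \<C> f = Dom \<C> g"
  shows "g \<cdot> f \<in> Arr \<C>" "Dom \<C> (g \<cdot> f) = Dom \<C> f" "Cod \<C> (g \<cdot> f) = Cod \<C> g"
  using comp_hom[of f _ _ g] assms by auto

lemma id_arr [simp]:
  assumes "A \<in> Obj \<C>"
  shows "Id \<C> A \<in> Arr \<C>" "Dom \<C> (Id \<C> A) = A" "Cod \<C> (Id \<C> A) = A"
  using id_hom[OF assms] by auto

text \<open>As a rewrite rule this brings every composite into right-nested form.\<close>

lemma comp_assoc' [simp]:
  assumes "f \<in> Arr \<C>" "g \<in> Arr \<C>" "h \<in> Arr \<C>" "Cod \<C> f = Dom \<C> g" "Cod \<C> g = Dom \<C> h"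
  shows "(h \<cdot> g) \<cdot> f = h \<cdot> (g \<cdot> f)"
  using comp_assoc[of f _ _ g _ h] assms by auto

lemma comp_Id [simp]: "\<lbrakk>f \<in> Arr \<C>; Dom \<C> f = A\<rbrakk> \<Longrightarrow> f \<cdot> Id \<C> A = f"
  and Id_comp [simp]: "\<lbrakk>f \<in> Arr \<C>; Cod \<C> f = A\<rbrakk> \<Longrightarrow> Id \<C> A \<cdot> f = f"
  using comp_id id_comp by auto

text \<open>In right-nested form \<open>g \<cdot> f\<close> is no longer a subterm of
  \<open>g \<cdot> (f \<cdot> h)\<close>; this makes a known value of \<open>g \<cdot> f\<close>
  applicable there.\<close>

lemma comp_subst:
  assumes "g \<cdot> f = k" "h \<in> Arr \<C>" "f \<in> Arr \<C>" "g \<in> Arr \<C>" "Cod \<C> h = Dom \<C> f" "Cod \<C> f = Dom \<C> g"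
  shows "g \<cdot> (f \<cdot> h) = k \<cdot> h"
  using assms by (metis comp_assoc')

end

section \<open>Arithmetic in the hom groups\<close>

context preadditive_category
begin

lemma group_hom: "\<lbrakk>A \<in> Obj \<C>; B \<in> Obj \<C>\<rbrakk> \<Longrightarrow> group (hom_group \<C> A B)"
  using hom_comm_group comm_group_def by blast

lemma hom_group_simps [simp]:
  "carrier (hom_group \<C> A B) = Hom \<C> A B"
  "mult (hom_group \<C> A B) = Plus \<C>"
  "one (hom_group \<C> A B) = Zero \<C> A B"
  by (simp_all add: hom_group_def)

lemma zero_arr [simp]:
  assumes "A \<in> Obj \<C>" "B \<in> Obj \<C>"
  shows "Zero \<C> A B \<in> Arr \<C>" "Dom \<C> (Zero \<C> A B) = A" "Cod \<C> (Zero \<C> A B) = B"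
  using group.is_monoid[OF group_hom[OF assms]] monoid.one_closed by fastforce+

lemma plus_arr [simp]:
  assumes "f \<in> Arr \<C>" "g \<in> Arr \<C>" "Dom \<C> f = Dom \<C> g" "Cod \<C> f = Cod \<C> g"
  shows "f \<boxplus> g \<in> Arr \<C>" "Dom \<C> (f \<boxplus> g) = Dom \<C> g" "Cod \<C> (f \<boxplus> g) = Cod \<C> g"
  using monoid.m_closed[OF group.is_monoid[OF group_hom], of "Dom \<C> g" "Cod \<C> g" f g] assms by auto

lemma plus_idem_imp_zero:
  assumes "f \<in> Arr \<C>" "f \<boxplus> f = f"
  shows "f = Zero \<C> (Dom \<C> f) (Cod \<C> f)"
  using group.r_cancel_one[OF group_hom[of "Dom \<C> f" "Cod \<C> f"], of f f] assms by simp

lemma zero_plus [simp]: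
  assumes "f \<in> Arr \<C>" "Dom \<C> f = A" "Cod \<C> f = B"
  shows "Zero \<C> A B \<boxplus> f = f" "f \<boxplus> Zero \<C> A B = f"
  using monoid.l_one[OF group.is_monoid[OF group_hom[of A B]], of f]
    monoid.r_one[OF group.is_monoid[OF group_hom[of A B]], of f] assms by auto

text \<open>Composition with \<open>g\<close> is additive, so the composite \<open>x\<close>
  satisfies \<open>x \<boxplus> x = x\<close> and is the neutral element of its hom group.\<close>

lemma comp_zero [simp]:
  assumes "g \<in> Arr \<C>" "Dom \<C> g = B" "A \<in> Obj \<C>"
  shows "g \<cdot> Zero \<C> A B = Zero \<C> A (Cod \<C> g)"
  using assms comp_plus[of "Zero \<C> A B" A B "Zero \<C> A B" g "Cod \<C> g"]
    plus_idem_imp_zero[of "g \<cdot> Zero \<C> A B"] by auto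

lemma zero_comp [simp]:
  assumes "f \<in> Arr \<C>" "Cod \<C> f = A" "B \<in> Obj \<C>"
  shows "Zero \<C> A B \<cdot> f = Zero \<C> (Dom \<C> f) B"
  using assms plus_comp[of f _ A "Zero \<C> A B" B "Zero \<C> A B"]
    plus_idem_imp_zero[of "Zero \<C> A B \<cdot> f"] by auto

text \<open>Negation is not an operation of the record, so differences are supplied as witnesses:
  here \<open>d\<close> is the group inverse of \<open>g\<close> plus \<open>f\<close>.\<close>

lemma ex_diff:
  assumes "f \<in> Hom \<C> A B" "g \<in> Hom \<C> A B"
  obtains d where "d \<in> Hom \<C> A B" "f = g \<boxplus> d"
proof -
  interpret group "hom_group \<C> A B"
    using assms group_hom by auto
  have "inv\<^bsub>hom_group \<C> A B\<^esub> g \<boxplus> f \<in> Hom \<C> A B"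
    using m_closed[of "inv\<^bsub>hom_group \<C> A B\<^esub> g" f] inv_closed[of g] assms by (simp del: Hom_iff)
  moreover have "f = g \<boxplus> (inv\<^bsub>hom_group \<C> A B\<^esub> g \<boxplus> f)"
    using m_assoc[of g "inv\<^bsub>hom_group \<C> A B\<^esub> g" f] inv_closed[of g] r_inv[of g] l_one[of f] assms
    by (simp del: Hom_iff)
  ultimately show thesis by (rule that)
qed

lemma plus_commute:
  assumes "f \<in> Hom \<C> A B" "g \<in> Hom \<C> A B"
  shows "f \<boxplus> g = g \<boxplus> f"
  using comm_monoid.m_comm[OF comm_group.axioms(1)[OF hom_comm_group[of A B]], of f g] assms by auto

lemma plus_left_cancel:
  assumes "h \<boxplus> f = h \<boxplus> g" "f \<in> Hom \<C> A B" "g \<in> Hom \<C> A B" "h \<in> Hom \<C> A B"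
  shows "f = g"
proof -
  interpret group "hom_group \<C> A B"
    using assms group_hom by auto
  have "f \<boxplus> h = g \<boxplus> h"
    using assms plus_commute by metis
  then show ?thesis
    using right_cancel[of h f g] assms(2-4) by (simp del: Hom_iff)
qed

end

section \<open>Duality\<close>

text \<open>\<open>Zero\<close> is indexed by domain and codomain and therefore swaps its arguments
  too. The type stays the same, so every result about exact categories can be instantiated at the
  opposite one.\<close>

definition op_cat :: "('o, 'm, 'x) ab_category_scheme \<Rightarrow> ('o, 'm, 'x) ab_category_scheme" where
  "op_cat \<C> = \<C>\<lparr>Dom := Cod \<C>, Cod := Dom \<C>, Comp := \<lambda>g f. Comp \<C> f g, Zero := \<lambda>A B. Zero \<C> B A\<rparr>"

lemma op_cat_simps [simp]:
  "Obj (op_cat \<C>) = Obj \<C>" "Arr (op_cat \<C>) = Arr \<C>"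
  "Dom (op_cat \<C>) = Cod \<C>" "Cod (op_cat \<C>) = Dom \<C>"
  "Id (op_cat \<C>) = Id \<C>" "Comp (op_cat \<C>) g f = Comp \<C> f g"
  "Plus (op_cat \<C>) = Plus \<C>" "Zero (op_cat \<C>) A B = Zero \<C> B A"
  by (simp_all add: op_cat_def)

lemma op_Hom: "Hom (op_cat \<C>) A B = Hom \<C> B A"
  by (auto simp: Hom_def)

lemma op_kernel: "is_kernel (op_cat \<C>) p i \<longleftrightarrow> is_cokernel \<C> p i"
  and op_cokernel: "is_cokernel (op_cat \<C>) i p \<longleftrightarrow> is_kernel \<C> i p"
  by (auto simp: is_kernel_def is_cokernel_def op_Hom simp del: Hom_iff)

lemma op_kernel_cokernel_pair: "kernel_cokernel_pair (op_cat \<C>) p i \<longleftrightarrow> kernel_cokernel_pair \<C> i p"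
  by (auto simp: kernel_cokernel_pair_def op_kernel op_cokernel)

lemma op_pushout: "is_pushout (op_cat \<C>) p f p' f' \<longleftrightarrow> is_pullback \<C> p f p' f'"
  and op_pullback: "is_pullback (op_cat \<C>) i f i' f' \<longleftrightarrow> is_pushout \<C> i f i' f'"
  unfolding is_pushout_def is_pullback_def op_Hom op_cat_simps by (auto simp del: Hom_iff)

lemma op_iso: "is_iso (op_cat \<C>) f \<longleftrightarrow> is_iso \<C> f"
  by (auto simp: is_iso_def)

lemma iso_pairsI:
  assumes "is_iso \<C> \<alpha>" "is_iso \<C> \<beta>" "is_iso \<C> \<gamma>"
    "\<alpha> \<in> Hom \<C> (Dom \<C> i) (Dom \<C> j)" "\<beta> \<in> Hom \<C> (Cod \<C> i) (Cod \<C> j)" "\<gamma> \<in> Hom \<C> (Cod \<C> p) (Cod \<C> q)"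
    "j \<cdot>\<^bsub>\<C>\<^esub> \<alpha> = \<beta> \<cdot>\<^bsub>\<C>\<^esub> i" "q \<cdot>\<^bsub>\<C>\<^esub> \<beta> = \<gamma> \<cdot>\<^bsub>\<C>\<^esub> p"
  shows "iso_pairs \<C> i p j q"
  using assms unfolding iso_pairs_def by blast

context category
begin

lemma iso_inverse:
  assumes "is_iso \<C> f"
  obtains g where "is_iso \<C> g" "g \<in> Hom \<C> (Cod \<C> f) (Dom \<C> f)"
    "g \<cdot> f = Id \<C> (Dom \<C> f)" "f \<cdot> g = Id \<C> (Cod \<C> f)"
proof -
  obtain g where g: "g \<in> Hom \<C> (Cod \<C> f) (Dom \<C> f)"
    "g \<cdot> f = Id \<C> (Dom \<C> f)" "f \<cdot> g = Id \<C> (Cod \<C> f)" and "f \<in> Arr \<C>"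
    using assms by (auto simp: is_iso_def)
  then have "is_iso \<C> g"
    by (auto simp: is_iso_def intro!: bexI[of _ f])
  with g show thesis using that by blast
qed

text \<open>Read in \<open>\<C>\<close>, the three given isomorphisms run from the pair
  \<open>(j, q)\<close> to \<open>(i, p)\<close>; their inverses form the required isomorphism of
  pairs.\<close>

lemma iso_pairs_op:
  assumes "iso_pairs (op_cat \<C>) p i q j" "i \<in> Arr \<C>" "p \<in> Arr \<C>" "j \<in> Arr \<C>" "q \<in> Arr \<C>"
    "Cod \<C> i = Dom \<C> p" "Cod \<C> j = Dom \<C> q"
  shows "iso_pairs \<C> i p j q"
proof -
  obtain \<gamma> \<beta> \<alpha> where iso: "is_iso \<C> \<alpha>" "is_iso \<C> \<beta>" "is_iso \<C> \<gamma>"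
    and hom: "\<gamma> \<in> Hom \<C> (Cod \<C> q) (Cod \<C> p)" "\<beta> \<in> Hom \<C> (Dom \<C> q) (Dom \<C> p)"
      "\<alpha> \<in> Hom \<C> (Dom \<C> j) (Dom \<C> i)"
    and eq: "\<gamma> \<cdot> q = p \<cdot> \<beta>" "\<beta> \<cdot> j = i \<cdot> \<alpha>"
    using assms(1) by (auto simp: iso_pairs_def op_iso)
  obtain \<alpha>' where 1: "is_iso \<C> \<alpha>'" "\<alpha>' \<in> Hom \<C> (Dom \<C> i) (Dom \<C> j)"
    "\<alpha>' \<cdot> \<alpha> = Id \<C> (Dom \<C> j)" "\<alpha> \<cdot> \<alpha>' = Id \<C> (Dom \<C> i)"
    using iso_inverse[OF iso(1)] hom by auto
  obtain \<beta>' where 2: "is_iso \<C> \<beta>'" "\<beta>' \<in> Hom \<C> (Dom \<C> p) (Dom \<C> q)"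
    "\<beta>' \<cdot> \<beta> = Id \<C> (Dom \<C> q)" "\<beta> \<cdot> \<beta>' = Id \<C> (Dom \<C> p)"
    using iso_inverse[OF iso(2)] hom by auto
  obtain \<gamma>' where 3: "is_iso \<C> \<gamma>'" "\<gamma>' \<in> Hom \<C> (Cod \<C> p) (Cod \<C> q)"
    "\<gamma>' \<cdot> \<gamma> = Id \<C> (Cod \<C> q)" "\<gamma> \<cdot> \<gamma>' = Id \<C> (Cod \<C> p)"
    using iso_inverse[OF iso(3)] hom by auto
  \<comment> \<open>Insert the identity \<open>\<beta>' \<cdot> \<beta>\<close> and move
    \<open>\<beta>\<close> past \<open>j\<close>; the same is done below with
    \<open>\<gamma>' \<cdot> \<gamma>\<close> and \<open>q\<close>.\<close>
  have "j \<cdot> \<alpha>' = \<beta>' \<cdot> (\<beta> \<cdot> j) \<cdot> \<alpha>'"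
    using assms hom 1 2 comp_subst[OF 2(3), of "j \<cdot> \<alpha>'"] by simp
  also have "\<dots> = \<beta>' \<cdot> i"
    using assms hom 1 2 by (simp add: eq)
  finally have e1: "j \<cdot> \<alpha>' = \<beta>' \<cdot> i" .
  have "q \<cdot> \<beta>' = \<gamma>' \<cdot> (\<gamma> \<cdot> q) \<cdot> \<beta>'"
    using assms hom 2 3 comp_subst[OF 3(3), of "q \<cdot> \<beta>'"] by simp
  also have "\<dots> = \<gamma>' \<cdot> p"
    using assms hom 2 3 by (simp add: eq)
  finally have e2: "q \<cdot> \<beta>' = \<gamma>' \<cdot> p" .
  show ?thesis
    by (rule iso_pairsI[of _ \<alpha>' \<beta>' \<gamma>']) (use 1 2 3 e1 e2 assms in auto)
qed

end

section \<open>The opposite of an exact category\<close>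

context exact_category
begin

lemma pair_arr:
  assumes "(i, p) \<in> \<E>"
  shows "i \<in> Arr \<C>" "p \<in> Arr \<C>" "Cod \<C> i = Dom \<C> p"
  using kernel_cokernel[OF assms] by (auto simp: kernel_cokernel_pair_def is_kernel_def)

lemma op_category: "category (op_cat \<C>)"
  by unfold_locales auto

lemma op_preadditive: "preadditive_category (op_cat \<C>)"
proof (intro preadditive_category.intro op_category preadditive_category_axioms.intro, goal_cases)
  case (1 A B)
  have "hom_group (op_cat \<C>) A B = hom_group \<C> B A"
    by (simp add: hom_group_def op_Hom del: Hom_iff)
  then show ?case using hom_comm_group 1 by simp
qed (auto simp: comp_plus plus_comp)

lemma op_additive: "additive_category (op_cat \<C>)"
proof (intro additive_category.intro op_preadditive additive_category_axioms.intro, goal_cases)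
  case 1
  have "zero_object (op_cat \<C>) Z \<longleftrightarrow> zero_object \<C> Z" for Z
    unfolding zero_object_def op_Hom op_cat_simps by blast
  then show ?case using ex_zero_object by simp
next
  case (2 A B)
  then obtain S i j p q where S: "S \<in> Obj \<C>" "biproduct \<C> A B S i j p q"
    using ex_biproduct by fastforce
  then have "biproduct (op_cat \<C>) A B S p q i j"
    by (auto simp: biproduct_def)
  then show ?case using S(1) unfolding op_cat_simps by blast
qed

text \<open>The axioms come in dual pairs, and each follows from its partner; closure under
  isomorphisms is self-dual up to reversing the isomorphism. This is the source of all later duality
  arguments.\<close>

lemma op_exact: "exact_category (op_cat \<C>) (\<E>\<inverse>)"
proof (intro exact_category.intro op_additive exact_category_axioms.intro, goal_cases)
  case (1 p i)
  then show ?case by (simp add: kernel_cokernel op_kernel_cokernel_pair)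
next
  case (2 p i q j)
  then have ip: "(i, p) \<in> \<E>" and jq: "kernel_cokernel_pair \<C> j q" 
    by (simp_all add: op_kernel_cokernel_pair)
  have "iso_pairs \<C> i p j q"
    by (rule iso_pairs_op[OF 2(3)])
      (use pair_arr[OF ip] jq in \<open>auto simp: kernel_cokernel_pair_def is_kernel_def\<close>)
  then show ?case using iso_closed[OF ip jq] by simp
next
  case (3 A)
  then show ?case using id_epic by (auto simp: admissible_monic_def admissible_epic_def)
next
  case (4 A)
  then show ?case using id_monic by (auto simp: admissible_monic_def admissible_epic_def)
next
  case (5 p q)
  then show ?case using comp_epic[of q p] by (auto simp: admissible_monic_def admissible_epic_def)
next
  case (6 i j)
  then show ?case using comp_monic[of j i] by (auto simp: admissible_monic_def admissible_epic_def)
next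
  case (7 p f)
  then show ?case using pullback_epic[of p f] by (auto simp: admissible_monic_def admissible_epic_def op_pushout)
next
  case (8 i f)
  then show ?case using pushout_monic[of i f] by (auto simp: admissible_monic_def admissible_epic_def op_pullback)
qed

end

section \<open>Kernels and cokernels\<close>

context category
begin

lemma kernel_arr:
  assumes "is_kernel \<C> i p"
  shows "i \<in> Arr \<C>" "p \<in> Arr \<C>" "Cod \<C> i = Dom \<C> p" "p \<cdot> i = Zero \<C> (Dom \<C> i) (Cod \<C> p)"
  using assms by (auto simp: is_kernel_def)

lemma cokernel_arr:
  assumes "is_cokernel \<C> p i"
  shows "i \<in> Arr \<C>" "p \<in> Arr \<C>" "Dom \<C> p = Cod \<C> i" "p \<cdot> i = Zero \<C> (Dom \<C> i) (Cod \<C> p)"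
  using assms by (auto simp: is_cokernel_def)

lemma kernel_lift:
  assumes "is_kernel \<C> i p" "t \<in> Hom \<C> X (Dom \<C> p)" "p \<cdot> t = Zero \<C> X (Cod \<C> p)"
  shows "\<exists>u. u \<in> Hom \<C> X (Dom \<C> i) \<and> i \<cdot> u = t"
proof -
  have "X \<in> Obj \<C>"
    using assms by auto
  then have "\<exists>!u. u \<in> Hom \<C> X (Dom \<C> i) \<and> i \<cdot> u = t"
    using assms unfolding is_kernel_def by blast
  then show ?thesis
    by blast
qed

lemma cokernel_extend:
  assumes "is_cokernel \<C> p i" "t \<in> Hom \<C> (Cod \<C> i) X" "t \<cdot> i = Zero \<C> (Dom \<C> i) X"
  shows "\<exists>u. u \<in> Hom \<C> (Cod \<C> p) X \<and> u \<cdot> p = t"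
proof -
  have "X \<in> Obj \<C>"
    using assms by auto
  then have "\<exists>!u. u \<in> Hom \<C> (Cod \<C> p) X \<and> u \<cdot> p = t"
    using assms unfolding is_cokernel_def by blast
  then show ?thesis
    by blast
qed

end

context preadditive_category
begin

text \<open>Both \<open>u\<close> and \<open>v\<close> factor the morphism
  \<open>i \<cdot> u\<close>, which \<open>p\<close> kills, so the uniqueness part of the universal
  property applies.\<close>

lemma kernel_mono:
  assumes "is_kernel \<C> i p" "i \<cdot> u = i \<cdot> v" "u \<in> Hom \<C> X (Dom \<C> i)" "v \<in> Hom \<C> X (Dom \<C> i)"
  shows "u = v"
proof -
  note i = kernel_arr[OF assms(1)]
  have "i \<cdot> u \<in> Hom \<C> X (Dom \<C> p)" "X \<in> Obj \<C>"
    using assms i by auto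
  moreover have "p \<cdot> (i \<cdot> u) = Zero \<C> X (Cod \<C> p)"
    using assms i comp_subst[OF i(4), of u] by simp
  ultimately have "\<exists>!w. w \<in> Hom \<C> X (Dom \<C> i) \<and> i \<cdot> w = i \<cdot> u"
    using assms(1) unfolding is_kernel_def by blast
  then show ?thesis
    using assms(2-4) by metis
qed

lemma cokernel_epi:
  assumes "is_cokernel \<C> p i" "u \<cdot> p = v \<cdot> p" "u \<in> Hom \<C> (Cod \<C> p) X" "v \<in> Hom \<C> (Cod \<C> p) X"
  shows "u = v"
proof -
  note i = cokernel_arr[OF assms(1)]
  have "u \<cdot> p \<in> Hom \<C> (Cod \<C> i) X" "X \<in> Obj \<C>"
    using assms i by auto
  moreover have "(u \<cdot> p) \<cdot> i = Zero \<C> (Dom \<C> i) X"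
    using assms i by simp
  ultimately have "\<exists>!w. w \<in> Hom \<C> (Cod \<C> p) X \<and> w \<cdot> p = u \<cdot> p"
    using assms(1) unfolding is_cokernel_def by blast
  then show ?thesis
    using assms(2-4) by metis
qed

lemma is_kernelI:
  assumes "i \<in> Arr \<C>" "p \<in> Arr \<C>" "Cod \<C> i = Dom \<C> p" "p \<cdot> i = Zero \<C> (Dom \<C> i) (Cod \<C> p)"
    and "\<And>t. \<lbrakk>t \<in> Arr \<C>; Cod \<C> t = Dom \<C> p; p \<cdot> t = Zero \<C> (Dom \<C> t) (Cod \<C> p)\<rbrakk>
      \<Longrightarrow> \<exists>u. u \<in> Hom \<C> (Dom \<C> t) (Dom \<C> i) \<and> i \<cdot> u = t"
    and "\<And>u v. \<lbrakk>u \<in> Arr \<C>; v \<in> Arr \<C>; Dom \<C> u = Dom \<C> v; Cod \<C> u = Dom \<C> i; Cod \<C> v = Dom \<C> i;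
        i \<cdot> u = i \<cdot> v\<rbrakk> \<Longrightarrow> u = v"
  shows "is_kernel \<C> i p"
  unfolding is_kernel_def
proof (intro conjI ballI impI ex_ex1I assms(1-4), goal_cases)
  case (1 X t)
  then show ?case using assms(5)[of t] by auto
next
  case (2 X t u v)
  then show ?case by (intro assms(6)[of u v]) simp_all
qed

lemma is_cokernelI:
  assumes "i \<in> Arr \<C>" "p \<in> Arr \<C>" "Cod \<C> i = Dom \<C> p" "p \<cdot> i = Zero \<C> (Dom \<C> i) (Cod \<C> p)"
    and "\<And>t. \<lbrakk>t \<in> Arr \<C>; Dom \<C> t = Cod \<C> i; t \<cdot> i = Zero \<C> (Dom \<C> i) (Cod \<C> t)\<rbrakk>
      \<Longrightarrow> \<exists>u. u \<in> Hom \<C> (Cod \<C> p) (Cod \<C> t) \<and> u \<cdot> p = t"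
    and "\<And>u v. \<lbrakk>u \<in> Arr \<C>; v \<in> Arr \<C>; Cod \<C> u = Cod \<C> v; Dom \<C> u = Cod \<C> p; Dom \<C> v = Cod \<C> p;
        u \<cdot> p = v \<cdot> p\<rbrakk> \<Longrightarrow> u = v"
  shows "is_cokernel \<C> p i"
  unfolding is_cokernel_def
proof (intro conjI ballI impI ex_ex1I assms(1-4), goal_cases)
  case (1 X t)
  then show ?case using assms(5)[of t] by auto
next
  case (2 X t u v)
  then show ?case by (intro assms(6)[of u v]) simp_all
qed

end

section \<open>Short exact sequences\<close>

context exact_category
begin

lemma pair_zero: "(i, p) \<in> \<E> \<Longrightarrow> p \<cdot> i = Zero \<C> (Dom \<C> i) (Cod \<C> p)"
  using kernel_cokernel by (auto simp: kernel_cokernel_pair_def is_kernel_def)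

lemma pair_kernel: "(i, p) \<in> \<E> \<Longrightarrow> is_kernel \<C> i p"
  and pair_cokernel: "(i, p) \<in> \<E> \<Longrightarrow> is_cokernel \<C> p i"
  using kernel_cokernel by (auto simp: kernel_cokernel_pair_def)

text \<open>Two cokernels of \<open>i\<close> differ by an isomorphism \<open>\<gamma>\<close>.
  Hence \<open>q\<close> has the same kernel as \<open>p\<close>, and \<open>(i, q)\<close> is a
  kernel-cokernel pair isomorphic to \<open>(i, p)\<close>.\<close>

lemma pair_change_cokernel:
  assumes ip: "(i, p) \<in> \<E>" and q: "is_cokernel \<C> q i"
  shows "(i, q) \<in> \<E>"
proof -
  note a = pair_arr[OF ip] pair_zero[OF ip] and p = pair_cokernel[OF ip] and b = cokernel_arr[OF q]
  obtain \<gamma> where \<gamma>: "\<gamma> \<in> Hom \<C> (Cod \<C> p) (Cod \<C> q)" "\<gamma> \<cdot> p = q"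
    using cokernel_extend[OF p, of q] b by auto
  obtain \<delta> where \<delta>: "\<delta> \<in> Hom \<C> (Cod \<C> q) (Cod \<C> p)" "\<delta> \<cdot> q = p"
    using cokernel_extend[OF q, of p] a by auto
  have "\<delta> \<cdot> \<gamma> = Id \<C> (Cod \<C> p)"
    by (rule cokernel_epi[OF p, where X = "Cod \<C> p"]) (use \<gamma> \<delta> a b in auto)
  moreover have "\<gamma> \<cdot> \<delta> = Id \<C> (Cod \<C> q)"
    by (rule cokernel_epi[OF q, where X = "Cod \<C> q"]) (use \<gamma> \<delta> a b in auto)
  ultimately have \<gamma>_iso: "is_iso \<C> \<gamma>"
    using \<gamma> \<delta> by (auto simp: is_iso_def)
  have Id_iso: "is_iso \<C> (Id \<C> A)" if "A \<in> Obj \<C>" for A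
    using that by (auto simp: is_iso_def)
  have "is_kernel \<C> i q"
  proof (rule is_kernelI)
    fix t
    assume t: "t \<in> Arr \<C>" "Cod \<C> t = Dom \<C> q" "q \<cdot> t = Zero \<C> (Dom \<C> t) (Cod \<C> q)"
    \<comment> \<open>Since \<open>p\<close> factors through \<open>q\<close>, it kills whatever
      \<open>q\<close> kills.\<close>
    have "p \<cdot> t = \<delta> \<cdot> (q \<cdot> t)"
      using \<delta> t a b comp_subst[OF \<delta>(2), of t] by simp
    then have "p \<cdot> t = Zero \<C> (Dom \<C> t) (Cod \<C> p)"
      using t \<delta> by simp
    with t a b obtain u where "u \<in> Hom \<C> (Dom \<C> t) (Dom \<C> i)" "i \<cdot> u = t"
      using kernel_lift[OF pair_kernel[OF ip], of t "Dom \<C> t"] by auto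
    then show "\<exists>u. u \<in> Hom \<C> (Dom \<C> t) (Dom \<C> i) \<and> i \<cdot> u = t"
      by blast
  next
    fix u v
    assume "u \<in> Arr \<C>" "v \<in> Arr \<C>" "Dom \<C> u = Dom \<C> v" "Cod \<C> u = Dom \<C> i" "Cod \<C> v = Dom \<C> i"
      "i \<cdot> u = i \<cdot> v"
    then show "u = v"
      by (intro kernel_mono[OF pair_kernel[OF ip], where X = "Dom \<C> v" and u = u and v = v]) auto
  qed (use b in auto)
  then have "kernel_cokernel_pair \<C> i q"
    using q by (simp add: kernel_cokernel_pair_def)
  moreover have "iso_pairs \<C> i p i q"
    by (rule iso_pairsI[of _ "Id \<C> (Dom \<C> i)" "Id \<C> (Cod \<C> i)" \<gamma>])
      (use \<gamma> \<gamma>_iso Id_iso a b in auto)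
  ultimately show ?thesis
    using iso_closed[OF ip] by blast
qed

lemma pair_change_kernel:
  assumes "(i, p) \<in> \<E>" "is_kernel \<C> j p"
  shows "(j, p) \<in> \<E>"
  using exact_category.pair_change_cokernel[OF op_exact, of p i j] assms by (simp add: op_cokernel)

text \<open>If \<open>p \<cdot> \<psi>\<close> kills \<open>t\<close>, then
  \<open>\<psi> \<cdot> t\<close> factors through \<open>i\<close>, and applying
  \<open>\<phi>\<close> recovers \<open>t\<close>. Stated separately because its dual is the
  cokernel half of \<open>pair_transport\<close>.\<close>

lemma pair_transport_kernel:
  assumes ip: "(i, p) \<in> \<E>" and \<phi>: "\<phi> \<in> Hom \<C> (Cod \<C> i) B" "\<psi> \<in> Hom \<C> B (Cod \<C> i)"
    and inv: "\<psi> \<cdot> \<phi> = Id \<C> (Cod \<C> i)" "\<phi> \<cdot> \<psi> = Id \<C> B"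
  shows "is_kernel \<C> (\<phi> \<cdot> i) (p \<cdot> \<psi>)"
proof (rule is_kernelI)
  note a = pair_arr[OF ip] pair_zero[OF ip]
  show "p \<cdot> \<psi> \<cdot> (\<phi> \<cdot> i) = Zero \<C> (Dom \<C> (\<phi> \<cdot> i)) (Cod \<C> (p \<cdot> \<psi>))"
    using a \<phi> comp_subst[OF inv(1), of i] by simp
  have \<phi>\<psi>: "\<phi> \<cdot> (\<psi> \<cdot> t) = t" if "t \<in> Arr \<C>" "Cod \<C> t = B" for t
    using comp_subst[OF inv(2), of t] \<phi> that by simp
  have \<psi>\<phi>: "\<psi> \<cdot> (\<phi> \<cdot> t) = t" if "t \<in> Arr \<C>" "Cod \<C> t = Cod \<C> i" for t
    using comp_subst[OF inv(1), of t] \<phi> that by simp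
  fix t
  assume t: "t \<in> Arr \<C>" "Cod \<C> t = Dom \<C> (p \<cdot> \<psi>)" "p \<cdot> \<psi> \<cdot> t = Zero \<C> (Dom \<C> t) (Cod \<C> (p \<cdot> \<psi>))"
  then obtain u where u: "u \<in> Hom \<C> (Dom \<C> t) (Dom \<C> i)" "i \<cdot> u = \<psi> \<cdot> t"
    using kernel_lift[OF pair_kernel[OF ip], of "\<psi> \<cdot> t" "Dom \<C> t"] a \<phi> by auto
  then have "\<phi> \<cdot> i \<cdot> u = t"
    using t a \<phi> \<phi>\<psi>[of t] by simp
  with u show "\<exists>u. u \<in> Hom \<C> (Dom \<C> t) (Dom \<C> (\<phi> \<cdot> i)) \<and> \<phi> \<cdot> i \<cdot> u = t"
    using a \<phi> by auto
next
  note a = pair_arr[OF ip] pair_zero[OF ip]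
  have \<psi>\<phi>: "\<psi> \<cdot> (\<phi> \<cdot> t) = t" if "t \<in> Arr \<C>" "Cod \<C> t = Cod \<C> i" for t
    using comp_subst[OF inv(1), of t] \<phi> that by simp
  fix u v
  assume u: "u \<in> Arr \<C>" "v \<in> Arr \<C>" "Dom \<C> u = Dom \<C> v" "Cod \<C> u = Dom \<C> (\<phi> \<cdot> i)"
    "Cod \<C> v = Dom \<C> (\<phi> \<cdot> i)" "\<phi> \<cdot> i \<cdot> u = \<phi> \<cdot> i \<cdot> v"
  then have "\<psi> \<cdot> (\<phi> \<cdot> (i \<cdot> u)) = \<psi> \<cdot> (\<phi> \<cdot> (i \<cdot> v))"
    using a \<phi> by simp
  then have "i \<cdot> u = i \<cdot> v"
    using u a \<phi> \<psi>\<phi> by simp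
  then show "u = v"
    by (intro kernel_mono[OF pair_kernel[OF ip], where X = "Dom \<C> v" and u = u and v = v]) (use u a \<phi> in auto)
qed (use pair_arr[OF ip] \<phi> in auto)

text \<open>Only the middle object is replaced, so \<open>\<phi>\<close> together with identities at
  both ends is an isomorphism of pairs.\<close>

lemma pair_transport:
  assumes ip: "(i, p) \<in> \<E>" and \<phi>: "\<phi> \<in> Hom \<C> (Cod \<C> i) B" "\<psi> \<in> Hom \<C> B (Cod \<C> i)"
    and inv: "\<psi> \<cdot> \<phi> = Id \<C> (Cod \<C> i)" "\<phi> \<cdot> \<psi> = Id \<C> B"
  shows "(\<phi> \<cdot> i, p \<cdot> \<psi>) \<in> \<E>"
proof -
  note a = pair_arr[OF ip]
  have "is_kernel \<C> (\<phi> \<cdot> i) (p \<cdot> \<psi>)"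
    by (rule pair_transport_kernel[OF assms])
  moreover have "is_cokernel \<C> (p \<cdot> \<psi>) (\<phi> \<cdot> i)"
    \<comment> \<open>In the opposite category \<open>\<phi>\<close> and \<open>\<psi>\<close>
      exchange roles.\<close>
    using exact_category.pair_transport_kernel[OF op_exact, of p i \<psi> B \<phi>] ip \<phi> inv a
    by (simp add: op_kernel)
  ultimately have "kernel_cokernel_pair \<C> (\<phi> \<cdot> i) (p \<cdot> \<psi>)"
    by (simp add: kernel_cokernel_pair_def)
  moreover have "p \<cdot> \<psi> \<cdot> \<phi> = p"
    using \<phi> inv a by simp
  moreover have "is_iso \<C> \<phi>" "is_iso \<C> (Id \<C> (Dom \<C> i))" "is_iso \<C> (Id \<C> (Cod \<C> p))"
    using \<phi> inv a by (auto simp: is_iso_def)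
  then have "iso_pairs \<C> i p (\<phi> \<cdot> i) (p \<cdot> \<psi>)"
    by (intro iso_pairsI[of _ "Id \<C> (Dom \<C> i)" \<phi> "Id \<C> (Cod \<C> p)"])
      (use \<phi> inv a in auto)
  ultimately show ?thesis
    using iso_closed[OF ip] by blast
qed

end

section \<open>Push-outs and pull-backs\<close>

context category
begin

lemma pushout_arr:
  assumes "is_pushout \<C> i f j h"
  shows "i \<in> Arr \<C>" "f \<in> Arr \<C>" "j \<in> Arr \<C>" "h \<in> Arr \<C>" "Dom \<C> f = Dom \<C> i"
    "Dom \<C> j = Cod \<C> f" "Dom \<C> h = Cod \<C> i" "Cod \<C> h = Cod \<C> j" "h \<cdot> i = j \<cdot> f"
  using assms by (auto simp: is_pushout_def)

lemma pullback_arr: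
  assumes "is_pullback \<C> p f q h"
  shows "p \<in> Arr \<C>" "f \<in> Arr \<C>" "q \<in> Arr \<C>" "h \<in> Arr \<C>" "Cod \<C> f = Cod \<C> p"
    "Cod \<C> q = Dom \<C> f" "Cod \<C> h = Dom \<C> p" "Dom \<C> h = Dom \<C> q" "p \<cdot> h = f \<cdot> q"
  using assms by (auto simp: is_pullback_def)

lemma pushout_sym:
  assumes "is_pushout \<C> i f j h"
  shows "is_pushout \<C> f i h j"
proof -
  note a = pushout_arr[OF assms]
  show ?thesis
    unfolding is_pushout_def
  proof (intro conjI ballI impI, goal_cases)
    case (7 X s t)
    then have "\<exists>!u. u \<in> Hom \<C> (Cod \<C> j) X \<and> u \<cdot> h = t \<and> u \<cdot> j = s"
      using assms unfolding is_pushout_def by metis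
    then show ?case
      unfolding a(8) by (simp only: conj_commute)
  qed (use a in auto)
qed

lemma pushout_extend:
  assumes "is_pushout \<C> i f j h" "s \<in> Hom \<C> (Cod \<C> i) X" "t \<in> Hom \<C> (Cod \<C> f) X" "s \<cdot> i = t \<cdot> f"
  shows "\<exists>u. u \<in> Hom \<C> (Cod \<C> j) X \<and> u \<cdot> h = s \<and> u \<cdot> j = t"
proof -
  have "X \<in> Obj \<C>"
    using assms by auto
  then have "\<exists>!u. u \<in> Hom \<C> (Cod \<C> j) X \<and> u \<cdot> h = s \<and> u \<cdot> j = t"
    using assms unfolding is_pushout_def by blast
  then show ?thesis
    by blast
qed

lemma pullback_lift:
  assumes "is_pullback \<C> p f q h" "s \<in> Hom \<C> X (Dom \<C> p)" "t \<in> Hom \<C> X (Dom \<C> f)" "p \<cdot> s = f \<cdot> t"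
  shows "\<exists>u. u \<in> Hom \<C> X (Dom \<C> q) \<and> h \<cdot> u = s \<and> q \<cdot> u = t"
proof -
  have "X \<in> Obj \<C>"
    using assms by auto
  then have "\<exists>!u. u \<in> Hom \<C> X (Dom \<C> q) \<and> h \<cdot> u = s \<and> q \<cdot> u = t"
    using assms unfolding is_pullback_def by blast
  then show ?thesis
    by blast
qed

text \<open>Both \<open>u\<close> and \<open>v\<close> solve the factorization problem posed by
  \<open>u \<cdot> h\<close> and \<open>u \<cdot> j\<close>.\<close>

lemma pushout_epi:
  assumes "is_pushout \<C> i f j h" "u \<in> Hom \<C> (Cod \<C> j) X" "v \<in> Hom \<C> (Cod \<C> j) X"
    "u \<cdot> h = v \<cdot> h" "u \<cdot> j = v \<cdot> j"
  shows "u = v"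
proof -
  note a = pushout_arr[OF assms(1)]
  have "u \<cdot> h \<cdot> i = u \<cdot> j \<cdot> f"
    using a assms(2) by simp
  moreover have "X \<in> Obj \<C>" "u \<cdot> h \<in> Hom \<C> (Cod \<C> i) X" "u \<cdot> j \<in> Hom \<C> (Cod \<C> f) X"
    using a assms(2) by auto
  ultimately have "\<exists>!w. w \<in> Hom \<C> (Cod \<C> j) X \<and> w \<cdot> h = u \<cdot> h \<and> w \<cdot> j = u \<cdot> j"
    using assms(1) unfolding is_pushout_def by blast
  then show ?thesis
    using assms(2-5) by metis
qed

lemma pullback_mono:
  assumes "is_pullback \<C> p f q h" "u \<in> Hom \<C> X (Dom \<C> q)" "v \<in> Hom \<C> X (Dom \<C> q)"
    "h \<cdot> u = h \<cdot> v" "q \<cdot> u = q \<cdot> v"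
  shows "u = v"
proof -
  note a = pullback_arr[OF assms(1)]
  have "p \<cdot> (h \<cdot> u) = f \<cdot> (q \<cdot> u)"
    using a assms(2) comp_subst[OF a(9), of u] by simp
  moreover have "X \<in> Obj \<C>" "h \<cdot> u \<in> Hom \<C> X (Dom \<C> p)" "q \<cdot> u \<in> Hom \<C> X (Dom \<C> f)"
    using a assms(2) by auto
  ultimately have "\<exists>!w. w \<in> Hom \<C> X (Dom \<C> q) \<and> h \<cdot> w = h \<cdot> u \<and> q \<cdot> w = q \<cdot> u"
    using assms(1) unfolding is_pullback_def by blast
  then show ?thesis
    using assms(2-5) by metis
qed

end

context preadditive_category
begin

text \<open>A morphism that kills \<open>j\<close> kills \<open>i\<close> after restriction along
  \<open>h\<close>, hence factors through \<open>p\<close> there.\<close>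

lemma pushout_cokernel:
  assumes po: "is_pushout \<C> i f j h" and p: "is_cokernel \<C> p i"
    and q: "q \<in> Hom \<C> (Cod \<C> j) (Cod \<C> p)" "q \<cdot> h = p" "q \<cdot> j = Zero \<C> (Dom \<C> j) (Cod \<C> p)"
  shows "is_cokernel \<C> q j"
proof (rule is_cokernelI)
  note a = pushout_arr[OF po] cokernel_arr[OF p]
  fix t
  assume t: "t \<in> Arr \<C>" "Dom \<C> t = Cod \<C> j" "t \<cdot> j = Zero \<C> (Dom \<C> j) (Cod \<C> t)"
  have "t \<cdot> h \<cdot> i = (t \<cdot> j) \<cdot> f"
    using t(1,2) a by simp
  also have "\<dots> = Zero \<C> (Dom \<C> i) (Cod \<C> t)"
    unfolding t(3) using t(1) a by simp
  finally obtain u where u: "u \<in> Hom \<C> (Cod \<C> p) (Cod \<C> t)" "u \<cdot> p = t \<cdot> h"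
    using cokernel_extend[OF p, of "t \<cdot> h" "Cod \<C> t"] t(1,2) a by auto
  \<comment> \<open>Compare on the two legs: on \<open>h\<close> both sides give
    \<open>t \<cdot> h\<close>, on \<open>j\<close> both vanish.\<close>
  have "u \<cdot> q = t"
    by (rule pushout_epi[OF po, where X = "Cod \<C> t"]) (use u t q a in auto)
  with u q show "\<exists>u. u \<in> Hom \<C> (Cod \<C> q) (Cod \<C> t) \<and> u \<cdot> q = t"
    by auto
next
  note a = pushout_arr[OF po] cokernel_arr[OF p]
  fix u v
  assume u: "u \<in> Arr \<C>" "v \<in> Arr \<C>" "Cod \<C> u = Cod \<C> v" "Dom \<C> u = Cod \<C> q" "Dom \<C> v = Cod \<C> q"
    "u \<cdot> q = v \<cdot> q"
  then have "(u \<cdot> q) \<cdot> h = (v \<cdot> q) \<cdot> h"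
    by simp
  then have "u \<cdot> p = v \<cdot> p"
    using u(1-5) q a by simp
  then show "u = v"
    by (intro cokernel_epi[OF p, where X = "Cod \<C> v" and u = u and v = v]) (use u q in auto)
qed (use pushout_arr[OF po] cokernel_arr[OF p] q in auto)

text \<open>\<open>r \<cdot> p\<close> kills \<open>t\<close> exactly when
  \<open>p \<cdot> t\<close> factors through \<open>f\<close>, and such a factorization is what a
  lift of \<open>t\<close> to the pull-back requires.\<close>

lemma pullback_kernel:
  assumes pb: "is_pullback \<C> p f q h" and r: "is_kernel \<C> f r"
  shows "is_kernel \<C> h (r \<cdot> p)"
proof (rule is_kernelI)
  note a = pullback_arr[OF pb] kernel_arr[OF r]
  show "r \<cdot> p \<cdot> h = Zero \<C> (Dom \<C> h) (Cod \<C> (r \<cdot> p))"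
    using a comp_subst[OF kernel_arr(4)[OF r], of q] by simp
  fix t
  assume t: "t \<in> Arr \<C>" "Cod \<C> t = Dom \<C> (r \<cdot> p)" "r \<cdot> p \<cdot> t = Zero \<C> (Dom \<C> t) (Cod \<C> (r \<cdot> p))"
  then obtain s where s: "s \<in> Hom \<C> (Dom \<C> t) (Dom \<C> f)" "f \<cdot> s = p \<cdot> t"
    using kernel_lift[OF r, of "p \<cdot> t" "Dom \<C> t"] a by auto
  then obtain u where "u \<in> Hom \<C> (Dom \<C> t) (Dom \<C> q)" "h \<cdot> u = t"
    using pullback_lift[OF pb, of t "Dom \<C> t" s] t a by auto
  then show "\<exists>u. u \<in> Hom \<C> (Dom \<C> t) (Dom \<C> h) \<and> h \<cdot> u = t"
    using a by auto
next
  note a = pullback_arr[OF pb] kernel_arr[OF r]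
  fix u v
  assume u: "u \<in> Arr \<C>" "v \<in> Arr \<C>" "Dom \<C> u = Dom \<C> v" "Cod \<C> u = Dom \<C> h" "Cod \<C> v = Dom \<C> h"
    "h \<cdot> u = h \<cdot> v"
  have "f \<cdot> (q \<cdot> u) = p \<cdot> (h \<cdot> u)"
    using comp_subst[OF a(9), of u] u(1-5) a by simp
  also have "\<dots> = f \<cdot> (q \<cdot> v)"
    unfolding u(6) using comp_subst[OF a(9), of v] u(1-5) a by simp
  finally have "q \<cdot> u = q \<cdot> v"
    by (rule kernel_mono[OF r, where X = "Dom \<C> v"]) (use u(1-5) a in auto)
  then show "u = v"
    by (intro pullback_mono[OF pb, where X = "Dom \<C> v" and u = u and v = v]) (use u a in auto)
qed (use pullback_arr[OF pb] kernel_arr[OF r] in auto)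

end

section \<open>Admissible push-outs, Noether's isomorphism theorem and the short five lemma\<close>

context exact_category
begin

text \<open>The axiom makes some push-out \<open>j0\<close> admissible. The comparison isomorphism
  with the given push-out transports its pair to \<open>j\<close>, and the resulting cokernel is
  then exchanged for \<open>q\<close>.\<close>

lemma pushout_pair:
  assumes ip: "(i, p) \<in> \<E>" and po: "is_pushout \<C> i f j h"
    and q: "q \<in> Hom \<C> (Cod \<C> j) (Cod \<C> p)" "q \<cdot> h = p" "q \<cdot> j = Zero \<C> (Dom \<C> j) (Cod \<C> p)"
  shows "(j, q) \<in> \<E>"
proof -
  note a = pushout_arr[OF po]
  obtain j0 h0 q0 where po0: "is_pushout \<C> i f j0 h0" and j0: "(j0, q0) \<in> \<E>"
    using pushout_monic[of i f] ip a by (auto simp: admissible_monic_def)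
  note a0 = pushout_arr[OF po0]
  obtain \<phi> where \<phi>: "\<phi> \<in> Hom \<C> (Cod \<C> j0) (Cod \<C> j)" "\<phi> \<cdot> h0 = h" "\<phi> \<cdot> j0 = j"
    using pushout_extend[OF po0, of h "Cod \<C> j" j] a by auto
  obtain \<psi> where \<psi>: "\<psi> \<in> Hom \<C> (Cod \<C> j) (Cod \<C> j0)" "\<psi> \<cdot> h = h0" "\<psi> \<cdot> j = j0"
    using pushout_extend[OF po, of h0 "Cod \<C> j0" j0] a0 by auto
  have "\<psi> \<cdot> \<phi> = Id \<C> (Cod \<C> j0)"
    by (rule pushout_epi[OF po0, where X = "Cod \<C> j0"]) (use \<phi> \<psi> a0 in auto)
  moreover have "\<phi> \<cdot> \<psi> = Id \<C> (Cod \<C> j)"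
    by (rule pushout_epi[OF po, where X = "Cod \<C> j"]) (use \<phi> \<psi> a in auto)
  ultimately have "(j, q0 \<cdot> \<psi>) \<in> \<E>"
    using pair_transport[OF j0, of \<phi> "Cod \<C> j" \<psi>] \<phi> \<psi> by simp
  then show ?thesis
    using pair_change_cokernel pushout_cokernel[OF po pair_cokernel[OF ip] q] by blast
qed

lemma pushout_exists:
  assumes ip: "(i, p) \<in> \<E>" and f: "f \<in> Arr \<C>" "Dom \<C> f = Dom \<C> i"
  obtains j h q where "is_pushout \<C> i f j h" "(j, q) \<in> \<E>" "q \<in> Hom \<C> (Cod \<C> j) (Cod \<C> p)"
    "q \<cdot> h = p" "q \<cdot> j = Zero \<C> (Cod \<C> f) (Cod \<C> p)"
proof -
  obtain j h where po: "is_pushout \<C> i f j h"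
    using pushout_monic[of i f] assms by (auto simp: admissible_monic_def)
  \<comment> \<open>\<open>q\<close> is induced on the push-out by \<open>p\<close> and the zero
    morphism.\<close>
  obtain q where q: "q \<in> Hom \<C> (Cod \<C> j) (Cod \<C> p)" "q \<cdot> h = p" "q \<cdot> j = Zero \<C> (Cod \<C> f) (Cod \<C> p)"
    using pushout_extend[OF po, of p "Cod \<C> p" "Zero \<C> (Cod \<C> f) (Cod \<C> p)"]
      pair_arr[OF ip] pair_zero[OF ip] f by auto
  moreover have "(j, q) \<in> \<E>"
    using pushout_pair[OF ip po] q pushout_arr[OF po] by simp
  ultimately show thesis
    using po that by blast
qed

text \<open>For admissible monics \<open>X -> Y -> Z\<close> this is the sequence
  \<open>Y/X -> Z/X -> Z/Y\<close>. The square formed by \<open>j\<close>, \<open>p\<close>,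
  \<open>m\<close> and \<open>r\<close> is a push-out, so \<open>m\<close> inherits admissibility
  and its cokernel from \<open>j\<close>.\<close>

lemma noether:
  assumes ip: "(i, p) \<in> \<E>" and jq: "(j, q) \<in> \<E>" and r: "(j \<cdot> i, r) \<in> \<E>" and ij: "Cod \<C> i = Dom \<C> j"
    and m: "m \<in> Hom \<C> (Cod \<C> p) (Cod \<C> r)" "m \<cdot> p = r \<cdot> j"
    and n: "n \<in> Hom \<C> (Cod \<C> r) (Cod \<C> q)" "n \<cdot> r = q"
  shows "(m, n) \<in> \<E>"
proof (rule pushout_pair[OF jq])
  note a = pair_arr[OF ip] pair_zero[OF ip] pair_arr[OF jq] pair_zero[OF jq] pair_arr[OF r] pair_zero[OF r]
  have dom_r: "Dom \<C> r = Cod \<C> j"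
    using a ij by simp
  show "is_pushout \<C> j p m r"
    unfolding is_pushout_def
  proof (intro conjI ballI impI ex_ex1I, goal_cases)
    case (7 X s t)
    \<comment> \<open>From \<open>s \<cdot> j = t \<cdot> p\<close> it follows that \<open>s\<close>
      kills \<open>j \<cdot> i\<close>, so it extends over the cokernel \<open>r\<close>.\<close>
    have "s \<cdot> (j \<cdot> i) = (t \<cdot> p) \<cdot> i"
      using 7 a ij comp_assoc'[of i j s] by simp
    also have "\<dots> = Zero \<C> (Dom \<C> i) X"
      using 7 a by simp
    finally obtain u where u: "u \<in> Hom \<C> (Cod \<C> r) X" "u \<cdot> r = s"
      using cokernel_extend[OF pair_cokernel[OF r], of s X] 7 a ij by auto
    have "(u \<cdot> m) \<cdot> p = (u \<cdot> r) \<cdot> j"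
      using u(1) m a ij dom_r by simp
    also have "\<dots> = t \<cdot> p"
      using u(2) 7 by simp
    finally have "u \<cdot> m = t"
      by (rule cokernel_epi[OF pair_cokernel[OF ip], where X = X]) (use u m 7 in auto)
    then show ?case
      using u m by auto
  next
    case (8 X s t u v)
    show ?case
      by (rule cokernel_epi[OF pair_cokernel[OF r], where X = X]) (use 8 m in auto)
  qed (use a ij m dom_r in auto)
  \<comment> \<open>Tested after the epic \<open>p\<close>, where the composite becomes
    \<open>q \<cdot> j\<close>.\<close>
  have "n \<cdot> m = Zero \<C> (Cod \<C> p) (Cod \<C> q)"
  proof (rule cokernel_epi[OF pair_cokernel[OF ip]])
    have "(n \<cdot> m) \<cdot> p = (n \<cdot> r) \<cdot> j"
      using m n(1) a ij dom_r by simp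
    also have "\<dots> = Zero \<C> (Dom \<C> j) (Cod \<C> q)"
      using n(2) a by simp
    finally show "(n \<cdot> m) \<cdot> p = Zero \<C> (Cod \<C> p) (Cod \<C> q) \<cdot> p"
      using a ij by simp
  qed (use m n a in auto)
  then show "n \<cdot> m = Zero \<C> (Dom \<C> m) (Cod \<C> q)"
    using m by simp
qed (use n m in auto)

text \<open>The morphism of short exact sequences \<open>(u, c)\<close> is the identity on the left
  end, so an error term killed by \<open>q\<close> comes from a morphism through \<open>j\<close>
  and can be corrected through \<open>i\<close>. The short five lemma is deduced from this
  result.\<close>

lemma pullback_of_pair_morphism:
  assumes ip: "(i, p) \<in> \<E>" and jq: "(j, q) \<in> \<E>"
    and u: "u \<in> Hom \<C> (Cod \<C> i) (Cod \<C> j)" "u \<cdot> i = j"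
    and c: "c \<in> Hom \<C> (Cod \<C> p) (Cod \<C> q)" "q \<cdot> u = c \<cdot> p"
  shows "is_pullback \<C> q c p u"
  unfolding is_pullback_def
proof (intro conjI ballI impI ex_ex1I, goal_cases)
  note a = pair_arr[OF ip] pair_zero[OF ip] pair_arr[OF jq] pair_zero[OF jq]
  have dom_j: "Dom \<C> j = Dom \<C> i"
    using u a by (metis Hom_iff comp_arr(2))
  case (7 X s t)
  obtain e h where pb: "is_pullback \<C> p t e h" and e: "admissible_epic \<E> e"
    using pullback_epic[of p t] ip 7 c by (auto simp: admissible_epic_def)
  then obtain m where me: "(m, e) \<in> \<E>"
    by (auto simp: admissible_epic_def)
  note b = pullback_arr[OF pb] pair_arr[OF me] pair_zero[OF me]
  have dom_e: "Cod \<C> e = X"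
    using b 7 by simp
  \<comment> \<open>The fill-in \<open>w\<close> is first found after restriction along the epic \<open>e\<close>, by subtracting from
    \<open>h\<close> a morphism through \<open>i\<close>, and then descends along \<open>e\<close>.\<close>
  obtain d where d: "d \<in> Hom \<C> (Dom \<C> e) (Cod \<C> j)" "u \<cdot> h = s \<cdot> e \<boxplus> d"
    using ex_diff[of "u \<cdot> h" "Dom \<C> e" "Cod \<C> j" "s \<cdot> e"] u 7 a b by auto
  have "q \<cdot> (s \<cdot> e) \<boxplus> q \<cdot> d = q \<cdot> (u \<cdot> h)"
    unfolding d(2) by (rule comp_plus[symmetric]) (use d 7 a b in auto)
  also have "\<dots> = c \<cdot> (t \<cdot> e)"
    using comp_subst[OF c(2), of h] u c 7 a b by simp
  also have "\<dots> = q \<cdot> (s \<cdot> e)"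
    using comp_subst[OF 7(4), of e] u c 7 a b by simp
  finally have "q \<cdot> (s \<cdot> e) \<boxplus> q \<cdot> d = q \<cdot> (s \<cdot> e) \<boxplus> Zero \<C> (Dom \<C> e) (Cod \<C> q)"
    using 7 a b by simp
  then have "q \<cdot> d = Zero \<C> (Dom \<C> e) (Cod \<C> q)"
    by (rule plus_left_cancel[where A = "Dom \<C> e" and B = "Cod \<C> q" and h = "q \<cdot> (s \<cdot> e)"]) (use d 7 a b in auto)
  then obtain k where k: "k \<in> Hom \<C> (Dom \<C> e) (Dom \<C> i)" "j \<cdot> k = d"
    using kernel_lift[OF pair_kernel[OF jq], of d "Dom \<C> e"] d a dom_j by auto
  \<comment> \<open>Removing \<open>i \<cdot> k\<close> from \<open>h\<close> cancels
    \<open>d\<close> under \<open>u\<close>, because \<open>u \<cdot> i = j\<close>, and changes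
    nothing under \<open>p\<close>, because \<open>p \<cdot> i\<close> vanishes.\<close>
  obtain h' where h': "h' \<in> Hom \<C> (Dom \<C> e) (Cod \<C> i)" "h = i \<cdot> k \<boxplus> h'"
    using ex_diff[of h "Dom \<C> e" "Cod \<C> i" "i \<cdot> k"] k a b by auto
  have "u \<cdot> (i \<cdot> k) = d"
    using comp_subst[OF u(2), of k] u(1) a k by simp
  then have "u \<cdot> h = d \<boxplus> u \<cdot> h'"
    unfolding h'(2) using comp_plus[of "i \<cdot> k" "Dom \<C> e" "Cod \<C> i" h' u "Cod \<C> j"] u(1) k(1) h'(1) a by simp
  moreover have "u \<cdot> h = d \<boxplus> s \<cdot> e"
    unfolding d(2) by (rule plus_commute[of _ "Dom \<C> e" "Cod \<C> j"]) (use d 7 a b in auto)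
  ultimately have "d \<boxplus> u \<cdot> h' = d \<boxplus> s \<cdot> e"
    by simp
  then have uh': "u \<cdot> h' = s \<cdot> e"
    by (rule plus_left_cancel[where A = "Dom \<C> e" and B = "Cod \<C> j" and h = d]) (use d u h' 7 a b in auto)
  have "p \<cdot> (i \<cdot> k) = Zero \<C> (Dom \<C> e) (Cod \<C> p)"
    using comp_subst[OF pair_zero[OF ip], of k] k a by simp
  then have "p \<cdot> h = p \<cdot> h'"
    unfolding h'(2) using comp_plus[of "i \<cdot> k" "Dom \<C> e" "Cod \<C> i" h' p "Cod \<C> p"] k(1) h'(1) a by simp
  then have ph': "p \<cdot> h' = t \<cdot> e"
    using b by simp
  \<comment> \<open>To descend along \<open>e\<close>, the morphism \<open>h'\<close> must kill its
    kernel \<open>m\<close>. First \<open>p\<close> kills \<open>h' \<cdot> m\<close>, which gives a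
    factor \<open>l\<close> through \<open>i\<close>; then \<open>j \<cdot> l\<close> is
    \<open>s \<cdot> e \<cdot> m\<close>, so \<open>l\<close> vanishes.\<close>
  have "p \<cdot> (h' \<cdot> m) = t \<cdot> (e \<cdot> m)"
    using comp_subst[OF ph', of m] h' 7 a b by simp
  then have "p \<cdot> (h' \<cdot> m) = Zero \<C> (Dom \<C> m) (Cod \<C> p)"
    using 7 b by simp
  then obtain l where l: "l \<in> Hom \<C> (Dom \<C> m) (Dom \<C> i)" "i \<cdot> l = h' \<cdot> m"
    using kernel_lift[OF pair_kernel[OF ip], of "h' \<cdot> m" "Dom \<C> m"] h'(1) a b by auto
  have "j \<cdot> l = u \<cdot> (h' \<cdot> m)"
    using comp_subst[OF u(2), of l] u(1) l a by simp
  also have "\<dots> = s \<cdot> (e \<cdot> m)"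
    using comp_subst[OF uh', of m] u(1) h'(1) 7 a b by simp
  also have "\<dots> = j \<cdot> Zero \<C> (Dom \<C> m) (Dom \<C> j)"
    using 7 a b by simp
  finally have "l = Zero \<C> (Dom \<C> m) (Dom \<C> j)"
    by (rule kernel_mono[OF pair_kernel[OF jq], where X = "Dom \<C> m"]) (use l a b dom_j in auto)
  then have "h' \<cdot> m = Zero \<C> (Dom \<C> m) (Cod \<C> i)"
    using l a b dom_j by simp
  then obtain w where w: "w \<in> Hom \<C> X (Cod \<C> i)" "w \<cdot> e = h'"
    using cokernel_extend[OF pair_cokernel[OF me], of h' "Cod \<C> i"] h'(1) a b dom_e by auto
  have "u \<cdot> w = s"
    by (rule cokernel_epi[OF pair_cokernel[OF me], where X = "Cod \<C> j"]) (use uh' w u 7 a b dom_e in auto)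
  moreover have "p \<cdot> w = t"
    by (rule cokernel_epi[OF pair_cokernel[OF me], where X = "Cod \<C> p"]) (use ph' w u 7 a b dom_e in auto)
  ultimately show ?case
    using w a by auto
next
  note a = pair_arr[OF ip] pair_zero[OF ip] pair_arr[OF jq] pair_zero[OF jq]
  have dom_j: "Dom \<C> j = Dom \<C> i"
    using u a by (metis Hom_iff comp_arr(2))
  case (8 X s t v w)
  \<comment> \<open>Two lifts differ by some \<open>d\<close> killed by both \<open>p\<close> and
    \<open>u\<close>. The first makes it \<open>i \<cdot> l\<close>, the second gives that
    \<open>j \<cdot> l\<close> vanishes, and \<open>j\<close> is monic.\<close>
  obtain d where d: "d \<in> Hom \<C> X (Dom \<C> p)" "v = w \<boxplus> d"
    using ex_diff[of v X "Dom \<C> p" w] 8 by blast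
  have "p \<cdot> w \<boxplus> p \<cdot> d = p \<cdot> v"
    unfolding d(2) by (rule comp_plus[symmetric]) (use d 8 a in auto)
  also have "\<dots> = p \<cdot> w \<boxplus> Zero \<C> X (Cod \<C> p)"
    using 8 a by auto
  finally have "p \<cdot> d = Zero \<C> X (Cod \<C> p)"
    by (rule plus_left_cancel[where A = X and B = "Cod \<C> p" and h = "p \<cdot> w"]) (use d 8 a in auto)
  then obtain l where l: "l \<in> Hom \<C> X (Dom \<C> i)" "i \<cdot> l = d"
    using kernel_lift[OF pair_kernel[OF ip], of d X] d by auto
  have "u \<cdot> w \<boxplus> u \<cdot> d = u \<cdot> v"
    unfolding d(2) by (rule comp_plus[symmetric]) (use d u 8 a in auto)
  also have "\<dots> = u \<cdot> w \<boxplus> Zero \<C> X (Cod \<C> u)"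
    using 8 u a by auto
  finally have "u \<cdot> d = Zero \<C> X (Cod \<C> u)"
    by (rule plus_left_cancel[where A = X and B = "Cod \<C> u" and h = "u \<cdot> w"]) (use d u 8 a in auto)
  then have "j \<cdot> l = j \<cdot> Zero \<C> X (Dom \<C> j)"
    using comp_subst[OF u(2), of l] l u a 8 by simp
  then have "l = Zero \<C> X (Dom \<C> j)"
    by (rule kernel_mono[OF pair_kernel[OF jq], where X = X]) (use l a 8 dom_j in auto)
  then have "d = Zero \<C> X (Dom \<C> p)"
    using l a 8 dom_j by auto
  then show ?case
    using d(2) 8 by simp
qed (use pair_arr[OF ip] pair_arr[OF jq] u c in auto)

text \<open>The dual statement: here the morphism of sequences is the identity on the right
  end.\<close>

lemma pushout_of_pair_morphism:
  assumes "(i, p) \<in> \<E>" "(j, q) \<in> \<E>"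
    and "u \<in> Hom \<C> (Cod \<C> i) (Cod \<C> j)" "q \<cdot> u = p"
    and "a \<in> Hom \<C> (Dom \<C> i) (Dom \<C> j)" "u \<cdot> i = j \<cdot> a"
  shows "is_pushout \<C> i a j u"
  using exact_category.pullback_of_pair_morphism[OF op_exact, of q j p i u a] assms pair_arr
  by (simp add: op_pullback)

text \<open>With identities at both ends, \<open>u\<close> is the pull-back of an identity along
  \<open>q\<close>, hence invertible.\<close>

lemma short_five:
  assumes ip: "(i, p) \<in> \<E>" and jq: "(j, q) \<in> \<E>"
    and u: "u \<in> Hom \<C> (Cod \<C> i) (Cod \<C> j)" "u \<cdot> i = j" "q \<cdot> u = p"
  obtains v where "v \<in> Hom \<C> (Cod \<C> j) (Cod \<C> i)" "v \<cdot> u = Id \<C> (Cod \<C> i)" "u \<cdot> v = Id \<C> (Cod \<C> j)"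
proof -
  note a = pair_arr[OF ip] pair_arr[OF jq]
  have qp: "Cod \<C> q = Cod \<C> p"
    using u a by (metis Hom_iff comp_arr(3))
  have pb: "is_pullback \<C> q (Id \<C> (Cod \<C> p)) p u"
    by (rule pullback_of_pair_morphism[OF ip jq]) (use u a qp in auto)
  \<comment> \<open>\<open>v\<close> is the lift of the compatible pair consisting of the identity
    and \<open>q\<close>.\<close>
  obtain v where v: "v \<in> Hom \<C> (Cod \<C> j) (Cod \<C> i)" "u \<cdot> v = Id \<C> (Cod \<C> j)" "p \<cdot> v = q"
    using pullback_lift[OF pb, of "Id \<C> (Cod \<C> j)" "Cod \<C> j" q] a qp by auto
  have "v \<cdot> u = Id \<C> (Cod \<C> i)"
    by (rule pullback_mono[OF pb, where X = "Cod \<C> i"])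
      (use u v a comp_subst[OF v(2), of u] comp_subst[OF v(3), of u] in auto)
  then show thesis
    using v that by blast
qed

end

section \<open>The three by three lemma\<close>

context exact_category
begin

text \<open>The object \<open>D\<close> of the outline is \<open>Cod \<C> h\<close>, with monics
  \<open>h\<close> from \<open>A\<close> and \<open>k\<close> from \<open>B'\<close>, their
  cokernels \<open>r\<close> onto \<open>C'\<close> and \<open>s\<close> onto \<open>A''\<close>,
  and the comparison \<open>j\<close> into \<open>B\<close>.\<close>

lemma three_by_three_lower:
  assumes rows: "f' \<in> Hom \<C> A' B'" "g' \<in> Hom \<C> B' C'"
      "f \<in> Hom \<C> A B" "g \<in> Hom \<C> B C"
      "f'' \<in> Hom \<C> A'' B''" "g'' \<in> Hom \<C> B'' C''"
    and columns: "a \<in> Hom \<C> A' A" "a' \<in> Hom \<C> A A''"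
      "b \<in> Hom \<C> B' B" "b' \<in> Hom \<C> B B''"
      "c \<in> Hom \<C> C' C" "c' \<in> Hom \<C> C C''"
    and commute: "b \<cdot> f' = f \<cdot> a" "c \<cdot> g' = g \<cdot> b"
      "b' \<cdot> f = f'' \<cdot> a'" "c' \<cdot> g = g'' \<cdot> b'"
    and columns_exact: "(a, a') \<in> \<E>" "(b, b') \<in> \<E>" "(c, c') \<in> \<E>"
    and fg: "(f, g) \<in> \<E>" and fg': "(f', g') \<in> \<E>"
  shows "(f'', g'') \<in> \<E>"
proof -
  note homs = rows columns
  obtain h k r where po: "is_pushout \<C> f' a h k" and hr: "(h, r) \<in> \<E>"
    and r: "r \<in> Hom \<C> (Cod \<C> h) C'" "r \<cdot> k = g'" "r \<cdot> h = Zero \<C> A C'"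
    using pushout_exists[OF fg', of a] homs by auto
  note d = pushout_arr[OF po]
  have "B' \<in> Obj \<C>" "A'' \<in> Obj \<C>"
    using homs dom_obj by auto
  then have "a' \<in> Hom \<C> (Cod \<C> a) A''" "Zero \<C> B' A'' \<in> Hom \<C> (Cod \<C> f') A''"
    "a' \<cdot> a = Zero \<C> B' A'' \<cdot> f'"
    using homs pair_zero[OF columns_exact(1)] by simp_all
  then obtain s where s: "s \<in> Hom \<C> (Cod \<C> h) A''" "s \<cdot> h = a'" "s \<cdot> k = Zero \<C> B' A''"
    using pushout_extend[OF pushout_sym[OF po]] unfolding d(8) by metis
  have ks: "(k, s) \<in> \<E>"
    by (rule pushout_pair[OF columns_exact(1) pushout_sym[OF po]]) (use s d homs in auto)
  obtain j where j: "j \<in> Hom \<C> (Cod \<C> h) B" "j \<cdot> k = b" "j \<cdot> h = f"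
    using pushout_extend[OF po, of b B f] homs commute by auto
  \<comment> \<open>On \<open>k\<close> this is the commuting square
    \<open>c \<cdot> g' = g \<cdot> b\<close>; on \<open>h\<close> both sides vanish.\<close>
  have gj: "g \<cdot> j = c \<cdot> r"
    by (rule pushout_epi[OF po, where X = C])
      (use j r d homs commute pair_zero[OF fg] in auto)
  \<comment> \<open>\<open>(h, r)\<close> maps to \<open>(f, g)\<close> by \<open>j\<close> and
    \<open>c\<close> with the identity on \<open>A\<close>. Thus \<open>j\<close> is the pull-back
    of the kernel \<open>c\<close>, and so a kernel of the admissible epic
    \<open>c' \<cdot> g\<close>.\<close>
  have pb: "is_pullback \<C> g c r j"
    by (rule pullback_of_pair_morphism[OF hr fg]) (use j r d homs gj in auto)
  have "is_kernel \<C> j (c' \<cdot> g)"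
    by (rule pullback_kernel[OF pb pair_kernel[OF columns_exact(3)]])
  moreover have "admissible_epic \<E> (c' \<cdot> g)"
    by (rule comp_epic) (use fg columns_exact homs in \<open>auto simp: admissible_epic_def\<close>)
  ultimately have jq: "(j, c' \<cdot> g) \<in> \<E>"
    using pair_change_kernel by (auto simp: admissible_epic_def)
  \<comment> \<open>On \<open>k\<close> both sides vanish; on \<open>h\<close> this is
    \<open>b' \<cdot> f = f'' \<cdot> a'\<close>.\<close>
  have f''s: "f'' \<cdot> s = b' \<cdot> j"
    by (rule pushout_epi[OF po, where X = B''])
      (use j s d homs commute pair_zero[OF columns_exact(2)] in auto)
  have "(j \<cdot> k, b') \<in> \<E>"
    using j columns_exact(2) by simp
  then show ?thesis
    by (rule noether[OF ks jq]) (use f''s j s d homs commute in auto)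
qed

text \<open>Passing to the opposite category turns the diagram by a half turn, so the reversed upper
  row becomes the lower row.\<close>

lemma three_by_three_upper:
  assumes rows: "f' \<in> Hom \<C> A' B'" "g' \<in> Hom \<C> B' C'"
      "f \<in> Hom \<C> A B" "g \<in> Hom \<C> B C"
      "f'' \<in> Hom \<C> A'' B''" "g'' \<in> Hom \<C> B'' C''"
    and columns: "a \<in> Hom \<C> A' A" "a' \<in> Hom \<C> A A''"
      "b \<in> Hom \<C> B' B" "b' \<in> Hom \<C> B B''"
      "c \<in> Hom \<C> C' C" "c' \<in> Hom \<C> C C''"
    and commute: "b \<cdot> f' = f \<cdot> a" "c \<cdot> g' = g \<cdot> b"
      "b' \<cdot> f = f'' \<cdot> a'" "c' \<cdot> g = g'' \<cdot> b'"
    and columns_exact: "(a, a') \<in> \<E>" "(b, b') \<in> \<E>" "(c, c') \<in> \<E>"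
    and "(f, g) \<in> \<E>" and "(f'', g'') \<in> \<E>"
  shows "(f', g') \<in> \<E>"
  using exact_category.three_by_three_lower[OF op_exact,
      of g'' C'' B'' f'' A'' g C B f A g' C' B' f' A' c' c b' b a' a] assms
  by simp

text \<open>The condition \<open>gf\<close> makes \<open>r\<close> kill \<open>h\<close> and lets
  \<open>g\<close> factor through the cokernel of \<open>f\<close>.\<close>

lemma three_by_three_middle:
  assumes rows: "f' \<in> Hom \<C> A' B'" "g' \<in> Hom \<C> B' C'"
      "f \<in> Hom \<C> A B" "g \<in> Hom \<C> B C"
      "f'' \<in> Hom \<C> A'' B''" "g'' \<in> Hom \<C> B'' C''"
    and columns: "a \<in> Hom \<C> A' A" "a' \<in> Hom \<C> A A''"
      "b \<in> Hom \<C> B' B" "b' \<in> Hom \<C> B B''"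
      "c \<in> Hom \<C> C' C" "c' \<in> Hom \<C> C C''"
    and commute: "b \<cdot> f' = f \<cdot> a" "c \<cdot> g' = g \<cdot> b"
      "b' \<cdot> f = f'' \<cdot> a'" "c' \<cdot> g = g'' \<cdot> b'"
    and columns_exact: "(a, a') \<in> \<E>" "(b, b') \<in> \<E>" "(c, c') \<in> \<E>"
    and fg': "(f', g') \<in> \<E>" and fg'': "(f'', g'') \<in> \<E>" and gf: "g \<cdot> f = Zero \<C> A C"
  shows "(f, g) \<in> \<E>"
proof -
  note homs = rows columns
  have objs: "A \<in> Obj \<C>" "B' \<in> Obj \<C>" "C'' \<in> Obj \<C>" "C' \<in> Obj \<C>" "C \<in> Obj \<C>"
    using homs dom_obj cod_obj by auto
  have "admissible_epic \<E> (g'' \<cdot> b')"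
    by (rule comp_epic) (use fg'' columns_exact homs in \<open>auto simp: admissible_epic_def\<close>)
  then obtain j where jq: "(j, g'' \<cdot> b') \<in> \<E>"
    by (auto simp: admissible_epic_def)
  define D where "D = Dom \<C> j"
  have j: "j \<in> Hom \<C> D B" "D \<in> Obj \<C>"
    using pair_arr[OF jq] homs by (auto simp: D_def)
  have qj: "g'' \<cdot> (b' \<cdot> j) = Zero \<C> D C''"
    using pair_zero[OF jq] j homs by simp
  \<comment> \<open>Equations between morphisms into \<open>D\<close> are checked after composing
    with \<open>j\<close>.\<close>
  have j_mono: "u = v" if "j \<cdot> u = j \<cdot> v" "u \<in> Hom \<C> X D" "v \<in> Hom \<C> X D" for u v X
    using kernel_mono[OF pair_kernel[OF jq] that(1), of X] that j by auto
  have b'b: "b' \<cdot> b = Zero \<C> B' B''" and c'c: "c' \<cdot> c = Zero \<C> C' C''"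
    and gf'': "g'' \<cdot> f'' = Zero \<C> A'' C''"
    using pair_zero columns_exact fg'' homs by auto
  obtain k where k: "k \<in> Hom \<C> B' D" "j \<cdot> k = b"
    using kernel_lift[OF pair_kernel[OF jq], of b B'] homs j b'b by auto
  have "g'' \<cdot> (b' \<cdot> f) = Zero \<C> A C''"
    using commute(3) homs objs comp_subst[OF gf'', of a'] by simp
  then obtain h where h: "h \<in> Hom \<C> A D" "j \<cdot> h = f"
    using kernel_lift[OF pair_kernel[OF jq], of f A] homs j by auto
  obtain s where s: "s \<in> Hom \<C> D A''" "f'' \<cdot> s = b' \<cdot> j"
    using kernel_lift[OF pair_kernel[OF fg''], of "b' \<cdot> j" D] homs j qj by auto
  have "c' \<cdot> (g \<cdot> j) = Zero \<C> D C''"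
    using comp_subst[OF commute(4), of j] homs j qj by simp
  then obtain r where r: "r \<in> Hom \<C> D C'" "c \<cdot> r = g \<cdot> j"
    using kernel_lift[OF pair_kernel[OF columns_exact(3)], of "g \<cdot> j" D] homs j by auto
  \<comment> \<open>Noether's theorem in the opposite category, for the epics \<open>b'\<close> and
    \<open>g''\<close>: the kernels of \<open>b'\<close>, of the composite and of \<open>g''\<close>
    form the sequence.\<close>
  have ks: "(k, s) \<in> \<E>"
    using exact_category.noether[OF op_exact, of g'' f'' b' b j s k] 
      fg'' columns_exact(2) jq homs j k s by simp
  have "f'' \<cdot> (s \<cdot> h) = f'' \<cdot> a'"
    using comp_subst[OF s(2), of h] s h j homs commute(3) by simp
  then have sh: "s \<cdot> h = a'"
    by (rule kernel_mono[OF pair_kernel[OF fg''], where X = A]) (use s h homs in auto)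
  have "j \<cdot> (h \<cdot> a) = j \<cdot> (k \<cdot> f')"
    using comp_subst[OF h(2), of a] comp_subst[OF k(2), of f'] h k j homs commute(1) by simp
  then have ha: "h \<cdot> a = k \<cdot> f'"
    by (rule j_mono[where X = A']) (use h k homs in auto)
  \<comment> \<open>\<open>h\<close> is the middle of a morphism from \<open>(a, a')\<close> to
    \<open>(k, s)\<close> with \<open>f'\<close> on the left and the identity on \<open>A''\<close>,
    so its left square is a push-out.\<close>
  have po: "is_pushout \<C> f' a h k"
    by (rule pushout_sym, rule pushout_of_pair_morphism[OF columns_exact(1) ks])
      (use h k s j homs sh ha in auto)
  have c_mono: "u = v" if "c \<cdot> u = c \<cdot> v" "u \<in> Hom \<C> X C'" "v \<in> Hom \<C> X C'" for u v X
    using kernel_mono[OF pair_kernel[OF columns_exact(3)] that(1), of X] that homs by auto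
  have "c \<cdot> (r \<cdot> k) = c \<cdot> g'"
    using comp_subst[OF r(2), of k] r k j homs commute(2) by simp
  then have rk: "r \<cdot> k = g'"
    by (rule c_mono[where X = B']) (use r k homs in auto)
  have "c \<cdot> (r \<cdot> h) = c \<cdot> Zero \<C> A C'"
    using comp_subst[OF r(2), of h] r h j homs gf objs by simp
  then have rh: "r \<cdot> h = Zero \<C> A C'"
    by (rule c_mono[where X = A]) (use r h homs objs in auto)
  have hr: "(h, r) \<in> \<E>"
    by (rule pushout_pair[OF fg' po]) (use h k r rk rh homs in auto)
  have "admissible_monic \<E> (j \<cdot> h)"
    by (rule comp_monic) (use hr jq h j in \<open>auto simp: admissible_monic_def\<close>)
  \<comment> \<open>\<open>f\<close> is now known to be an admissible monic, but its cokernel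
    \<open>p\<close> has still to be compared with \<open>g\<close>.\<close>
  then obtain p where fp: "(f, p) \<in> \<E>"
    using h by (auto simp: admissible_monic_def)
  define K where "K = Cod \<C> p"
  have p: "p \<in> Hom \<C> B K" "K \<in> Obj \<C>"
    using pair_arr[OF fp] homs by (auto simp: K_def)
  have pf: "p \<cdot> f = Zero \<C> A K"
    using pair_zero[OF fp] homs by (simp add: K_def)
  have p_epi: "u = v" if "u \<cdot> p = v \<cdot> p" "u \<in> Hom \<C> K X" "v \<in> Hom \<C> K X" for u v X
    using cokernel_epi[OF pair_cokernel[OF fp] that(1), of X] that p by auto
  have "p \<cdot> j \<cdot> h = Zero \<C> A K"
    using p j h pf by simp
  then obtain m where m: "m \<in> Hom \<C> C' K" "m \<cdot> r = p \<cdot> j"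
    using cokernel_extend[OF pair_cokernel[OF hr], of "p \<cdot> j" K] p h r j by auto
  have "g'' \<cdot> b' \<cdot> f = Zero \<C> A C''"
    using \<open>g'' \<cdot> (b' \<cdot> f) = Zero \<C> A C''\<close> homs by simp
  then obtain n where n: "n \<in> Hom \<C> K C''" "n \<cdot> p = g'' \<cdot> b'"
    using cokernel_extend[OF pair_cokernel[OF fp], of "g'' \<cdot> b'" C''] p homs by auto
  have "(j \<cdot> h, p) \<in> \<E>"
    using h fp by simp
  \<comment> \<open>Applied to \<open>A -> D -> B\<close>, whose cokernels are \<open>C'\<close> for
    \<open>h\<close>, \<open>C''\<close> for \<open>j\<close> and \<open>K\<close> for the composite
    \<open>f\<close>.\<close>
  then have mn: "(m, n) \<in> \<E>"
    by (rule noether[OF hr jq]) (use h j m n r p homs in auto)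
  obtain w where w: "w \<in> Hom \<C> K C" "w \<cdot> p = g"
    using cokernel_extend[OF pair_cokernel[OF fp], of g C] p homs gf by auto
  have "w \<cdot> m = c"
  proof (rule cokernel_epi[OF pair_cokernel[OF hr]])
    show "(w \<cdot> m) \<cdot> r = c \<cdot> r"
      using comp_subst[OF w(2), of j] w(1) m r p j homs by simp
  qed (use w m r homs in auto)
  moreover have "c' \<cdot> w = n"
  proof (rule p_epi)
    show "(c' \<cdot> w) \<cdot> p = n \<cdot> p"
      using w p n homs commute(4) by simp
  qed (use w n homs in auto)
  \<comment> \<open>\<open>w\<close> maps \<open>(m, n)\<close> to \<open>(c, c')\<close> with
    identities at both ends, hence is invertible.\<close>
  ultimately obtain v where v: "v \<in> Hom \<C> C K" "v \<cdot> w = Id \<C> K" "w \<cdot> v = Id \<C> C"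
    using short_five[OF mn columns_exact(3), of w] w m homs by auto
  \<comment> \<open>\<open>g\<close> is the cokernel \<open>p\<close> followed by the isomorphism
    \<open>w\<close>, so a factorization \<open>x\<close> over \<open>p\<close> becomes
    \<open>x \<cdot> v\<close> over \<open>g\<close>.\<close>
  have "is_cokernel \<C> g f"
  proof (rule is_cokernelI)
    fix t
    assume t: "t \<in> Arr \<C>" "Dom \<C> t = Cod \<C> f" "t \<cdot> f = Zero \<C> (Dom \<C> f) (Cod \<C> t)"
    then obtain x where x: "x \<in> Hom \<C> K (Cod \<C> t)" "x \<cdot> p = t"
      using cokernel_extend[OF pair_cokernel[OF fp], of t "Cod \<C> t"] p by auto
    have "v \<cdot> g = p"
      using comp_subst[OF v(2), of p] v(1) w p by auto
    then have "(x \<cdot> v) \<cdot> g = t"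
      using x v(1) homs by simp
    then show "\<exists>u. u \<in> Hom \<C> (Cod \<C> g) (Cod \<C> t) \<and> u \<cdot> g = t"
      using x v(1) homs by (intro exI[of _ "x \<cdot> v"]) auto
  next
    fix x y
    assume x: "x \<in> Arr \<C>" "y \<in> Arr \<C>" "Cod \<C> x = Cod \<C> y" "Dom \<C> x = Cod \<C> g" "Dom \<C> y = Cod \<C> g"
      "x \<cdot> g = y \<cdot> g"
    then have "x \<cdot> w \<cdot> p = y \<cdot> w \<cdot> p"
      using w p homs by simp
    then have "x \<cdot> w = y \<cdot> w"
      by (rule p_epi) (use x w homs in auto)
    then have "x \<cdot> w \<cdot> v = y \<cdot> w \<cdot> v"
      by simp
    then show "x = y"
      using x(1-5) v w(1) homs by simp
  qed (use homs gf in auto)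
  then show ?thesis
    by (rule pair_change_cokernel[OF fp])
qed

end

theorem corollary3p6:
  fixes \<C> :: "('o, 'm, 'x) ab_category_scheme" (structure)
    and \<E> :: "('m \<times> 'm) set"
    and A' A A'' B' B B'' C' C C'' :: 'o
    and f' g' f g f'' g'' a a' b b' c c' :: 'm
  assumes exact: "exact_category \<C> \<E>"
    and rows: "f' \<in> Hom \<C> A' B'" "g' \<in> Hom \<C> B' C'"
      "f \<in> Hom \<C> A B" "g \<in> Hom \<C> B C"
      "f'' \<in> Hom \<C> A'' B''" "g'' \<in> Hom \<C> B'' C''"
    and columns: "a \<in> Hom \<C> A' A" "a' \<in> Hom \<C> A A''"
      "b \<in> Hom \<C> B' B" "b' \<in> Hom \<C> B B''"
      "c \<in> Hom \<C> C' C" "c' \<in> Hom \<C> C C''"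
    and commute: "b \<cdot> f' = f \<cdot> a" "c \<cdot> g' = g \<cdot> b"
      "b' \<cdot> f = f'' \<cdot> a'" "c' \<cdot> g = g'' \<cdot> b'"
    and columns_exact: "(a, a') \<in> \<E>" "(b, b') \<in> \<E>" "(c, c') \<in> \<E>"
  shows "((f, g) \<in> \<E> \<and> (f', g') \<in> \<E> \<longrightarrow> (f'', g'') \<in> \<E>) \<and>
         ((f, g) \<in> \<E> \<and> (f'', g'') \<in> \<E> \<longrightarrow> (f', g') \<in> \<E>) \<and>
         ((f', g') \<in> \<E> \<and> (f'', g'') \<in> \<E> \<and> g \<cdot> f = Zero \<C> A C \<longrightarrow> (f, g) \<in> \<E>)"
proof -
  interpret exact_category \<C> \<E>
    by (rule exact)
  show ?thesis
    using three_by_three_lower[OF rows columns commute columns_exact]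
      three_by_three_upper[OF rows columns commute columns_exact]
      three_by_three_middle[OF rows columns commute columns_exact] by blast
qed

end
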